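(* Let $n\in\mathbb{N}$, $\alpha\in(0,1]$, and let $\lambda\in C^{n,\alpha}[0,T]$ generate the Loewner curve $\gamma$ (parametrized by halfplane capacity). Then there are real numbers $a_2,a_3,\dots,a_{2n+1}$, where each $a_m$ depends only on $\lambda^{(k)}(0)$ for $k=1,\dots,\lfloor m/2\rfloor$, such that as $t\to0^+$: if $\alpha\le 1/2$, $$\gamma(t)=2i\sqrt t+a_2t+i\,a_3t^{3/2}+a_4t^2+\cdots+a_{2n}t^n+O(t^{n+\alpha});$$ if $\alpha>1/2$, $$\gamma(t)=2i\sqrt t+a_2t+i\,a_3t^{3/2}+a_4t^2+\cdots+a_{2n}t^n+i\,a_{2n+1}t^{n+1/2}+O(t^{n+\alpha}).$$ (Here the terms alternate: $a_m t^{m/2}$ for even $m$ and $i\,a_m t^{m/2}$ for odd $m$.)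
   Context: Chordal Loewner equation: for a continuous real function $\lambda$ on $[0,T]$ and $z\in\mathbb{H}$, $g_t(z)$ solves $\partial_t g_t(z)=\frac{2}{g_t(z)-\lambda(t)}$, $g_0(z)=z$; $K_t$ is the set of $z$ whose solution hits $\lambda$ by time $t$; $g_t:\mathbb{H}\setminus K_t\to\mathbb{H}$ is conformal with $g_t(z)=z+\frac{2t}{z}+O(z^{-2})$ at $\infty$. $\lambda$ generates $\gamma:[0,T]\to\overline{\mathbb{H}}$ if $\mathbb{H}\setminus K_t$ is the unbounded component of $\mathbb{H}\setminus\gamma(0,t]$ for each $t$; then $\gamma$ is parametrized by halfplane capacity. $\phi\in C^{n,\alpha}(I)$ means $\phi',\dots,\phi^{(n)}$ exist, are continuous and bounded on $I$, and $\phi^{(n)}$ is $\alpha$-Hölder on $I$ (Lipschitz if $\alpha=1$).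
   Formalization: The formal statement adds the normalization λ(0)=0; without it the expansion fails (λ≡1 generates γ(t)=1+2i√t, which has a nonzero constant term), and it fails for every λ with λ(0)≠0. *)

theory Defs
  imports "HOL-Analysis.Analysis" "HOL-Library.Landau_Symbols"
begin

definition upper_half_plane :: "complex set" where
  "upper_half_plane = {z. Im z > 0}"

definition loewner_hull :: "(real \<Rightarrow> real) \<Rightarrow> real \<Rightarrow> complex set" where
  "loewner_hull lam t = {z \<in> upper_half_plane.
     \<not> (\<exists>g :: real \<Rightarrow> complex. g 0 = z \<and>
          (\<forall>s\<in>{0..t}. g s \<noteq> complex_of_real (lam s) \<and>
             (g has_vector_derivative 2 / (g s - complex_of_real (lam s))) (at s within {0..t})))}"

definition generates_curve :: "real \<Rightarrow> (real \<Rightarrow> real) \<Rightarrow> (real \<Rightarrow> complex) \<Rightarrow> bool" where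
  "generates_curve T lam gam \<longleftrightarrow>
     continuous_on {0..T} lam \<and> continuous_on {0..T} gam \<and>
     (\<forall>t\<in>{0..T}. Im (gam t) \<ge> 0) \<and>
     (\<forall>t\<in>{0..T}.
        (\<exists>x \<in> upper_half_plane - gam ` {0<..t}.
           upper_half_plane - loewner_hull lam t =
             connected_component_set (upper_half_plane - gam ` {0<..t}) x \<and>
           \<not> bounded (connected_component_set (upper_half_plane - gam ` {0<..t}) x)))"

definition holder_Cn :: "nat \<Rightarrow> real \<Rightarrow> real \<Rightarrow> (real \<Rightarrow> real) \<Rightarrow> (nat \<Rightarrow> real \<Rightarrow> real) \<Rightarrow> bool" where
  "holder_Cn n \<alpha> T lam D \<longleftrightarrow>
     (\<forall>t\<in>{0..T}. D 0 t = lam t) \<and>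
     (\<forall>k<n. \<forall>t\<in>{0..T}. (D k has_real_derivative D (Suc k) t) (at t within {0..T})) \<and>
     (\<forall>k\<le>n. continuous_on {0..T} (D k) \<and> bounded (D k ` {0..T})) \<and>
     (\<exists>C. \<forall>s\<in>{0..T}. \<forall>t\<in>{0..T}. \<bar>D n s - D n t\<bar> \<le> C * \<bar>s - t\<bar> powr \<alpha>)"

definition exp_term :: "nat \<Rightarrow> real \<Rightarrow> real \<Rightarrow> complex" where
  "exp_term m a t = (if even m then 1 else \<i>) * complex_of_real (a * t powr (real m / 2))"

end

theory Submission
  imports Defs "HOL-Complex_Analysis.Complex_Analysis"
begin

text \<open>
  Run the Loewner flow backwards from time \<open>t\<close>: \<open>w' = - 2 / w + \<lambda>'(t - u)\<close>, \<open>w(0) = 0\<close>. Equivalently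
  \<open>w\<^sup>2 = - 4 u + 2 \<integral> w \<lambda>'\<close>, and with \<open>u = t \<sigma>\<^sup>2\<close>, \<open>w = \<surd>t \<sigma> Z(\<sigma>)\<close> this becomes a nonsingular fixed point
  equation for \<open>Z\<close> on \<open>[0,1]\<close> with driver \<open>Q(\<sigma>) = \<surd>t \<lambda>'(t (1 - \<sigma>\<^sup>2))\<close>, which is a contraction when \<open>Q\<close> is
  small. The point \<open>\<surd>t Z(1)\<close> is swallowed exactly at time \<open>t\<close> and depends continuously on \<open>t\<close>; being a
  limit of points swallowed later, it must be \<open>\<gamma>(t)\<close>.

  The solution is Lipschitz in \<open>Q\<close>, so replacing \<open>\<lambda>'\<close> by its Taylor polynomial changes \<open>\<gamma>(t)\<close> by
  \<open>O(t\<^bsup>n+\<alpha>\<^esup>)\<close>. For the Taylor polynomial, \<open>Z(1)\<close> is holomorphic in \<open>\<epsilon> = \<surd>t\<close>, and its Taylor coefficients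
  give the expansion. Their parity comes from the reflection \<open>Z \<mapsto> - cnj Z\<close>, \<open>\<epsilon> \<mapsto> - \<epsilon>\<close>, and their
  dependence on \<open>\<lambda>\<^bsup>(k)\<^esup>(0)\<close> is controlled by the fact that this derivative enters with a factor \<open>\<epsilon>\<^bsup>2k-1\<^esup>\<close>.
\<close>

section \<open>The rescaled fixed point equation\<close>

text \<open>The moment equals \<open>\<sigma>\<^sup>-\<^sup>2 \<integral>\<^sub>0\<^sup>\<sigma> x\<^sup>2 F(x) dx\<close>, written so that it is regular at \<open>\<sigma> = 0\<close>.\<close>

definition moment :: "(real \<Rightarrow> complex) \<Rightarrow> real \<Rightarrow> complex" where
  "moment F \<sigma> = of_real \<sigma> * integral {0..1} (\<lambda>\<theta>. of_real (\<theta>\<^sup>2) * F (\<sigma> * \<theta>))"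

text \<open>Along the backward flow \<open>(w^2)' = -4 + 2 w \<lambda>'\<close>, which rescales to
  \<open>Z^2 = -4 (1 - moment (Z Q))\<close>. The factor \<open>2 * \<i>\<close> with the principal
  root selects the branch near \<open>2 * \<i>\<close>, the one in the upper half-plane.\<close>

definition loewner_step :: "(real \<Rightarrow> complex) \<Rightarrow> (real \<Rightarrow> complex) \<Rightarrow> real \<Rightarrow> complex" where
  "loewner_step Q Z \<sigma> = 2 * \<i> * csqrt (1 - moment (\<lambda>x. Z x * Q x) \<sigma>)"

definition loewner_iter :: "(real \<Rightarrow> complex) \<Rightarrow> nat \<Rightarrow> real \<Rightarrow> complex" where
  "loewner_iter Q k = (loewner_step Q ^^ k) (\<lambda>_. 2 * \<i>)"

definition profile :: "(real \<Rightarrow> complex) \<Rightarrow> real \<Rightarrow> complex" where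
  "profile Q \<sigma> = lim (\<lambda>k. loewner_iter Q k \<sigma>)"

text \<open>With \<open>norm Z \<le> 3\<close> the bound 1/24 keeps \<open>Z * Q\<close>, and hence
  its moment, within 1/8. There \<open>1 - m\<close> stays away from the branch cut and the square
  root is 1-Lipschitz.\<close>

definition small_driver :: "(real \<Rightarrow> complex) \<Rightarrow> bool" where
  "small_driver Q \<longleftrightarrow> continuous_on {0..1} Q \<and> (\<forall>x\<in>{0..1}. norm (Q x) \<le> 1/24)"

text \<open>The closed unit ball around the constant \<open>2 * \<i>\<close>, which is the profile
  of the zero driver; on it the iteration is a contraction.\<close>

definition near_vertical :: "(real \<Rightarrow> complex) \<Rightarrow> bool" where
  "near_vertical Z \<longleftrightarrow> continuous_on {0..1} Z \<and> (\<forall>x\<in>{0..1}. norm (Z x - 2 * \<i>) \<le> 1)"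

section \<open>The moment operator: bounds and continuity\<close>

lemma mult_mem_unit_interval:
  fixes x y :: real
  assumes "x \<in> {0..1}" "y \<in> {0..1}"
  shows "x * y \<in> {0..1}"
  using assms by (auto simp: mult_le_one)

lemma continuous_on_moment_integrand:
  fixes F :: "real \<Rightarrow> complex"
  assumes "continuous_on {0..1} F" "\<sigma> \<in> {0..1}"
  shows "continuous_on {0..1} (\<lambda>\<theta>. of_real (\<theta>\<^sup>2) * F (\<sigma> * \<theta>))"
proof -
  have "continuous_on {0..1} (\<lambda>\<theta>. F (\<sigma> * \<theta>))"
    by (rule continuous_on_compose2[OF assms(1), of _ "\<lambda>\<theta>. \<sigma> * \<theta>"])
       (use mult_mem_unit_interval[OF assms(2)] in \<open>auto simp only: image_subset_iff intro!: continuous_intros\<close>)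
  then show ?thesis by (intro continuous_intros)
qed

lemma integrable_moment_integrand:
  fixes F :: "real \<Rightarrow> complex"
  assumes "continuous_on {0..1} F" "\<sigma> \<in> {0..1}"
  shows "(\<lambda>\<theta>. of_real (\<theta>\<^sup>2) * F (\<sigma> * \<theta>)) integrable_on {0..1}"
  using continuous_on_moment_integrand[OF assms] by (rule integrable_continuous_real)

lemma moment_diff:
  assumes "continuous_on {0..1} F" "continuous_on {0..1} G" "\<sigma> \<in> {0..1}"
  shows "moment F \<sigma> - moment G \<sigma> = moment (\<lambda>x. F x - G x) \<sigma>"
  using integral_diff[OF integrable_moment_integrand[OF assms(1,3)] integrable_moment_integrand[OF assms(2,3)]]
  by (simp add: moment_def right_diff_distrib)

lemma norm_moment_le:
  assumes F: "continuous_on {0..1} F" and B: "\<And>x. x \<in> {0..1} \<Longrightarrow> norm (F x) \<le> B"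
    and \<sigma>: "\<sigma> \<in> {0..1}"
  shows "norm (moment F \<sigma>) \<le> B"
proof -
  have "norm (integral {0..1} (\<lambda>\<theta>. of_real (\<theta>\<^sup>2) * F (\<sigma> * \<theta>))) \<le> B * (1 - 0)"
  proof (rule integral_bound)
    fix \<theta> :: real assume \<theta>: "\<theta> \<in> {0..1}"
    have "norm (F (\<sigma> * \<theta>)) \<le> B" by (rule B[OF mult_mem_unit_interval[OF \<sigma> \<theta>]])
    moreover have "\<theta>\<^sup>2 \<le> 1" using \<theta> by (simp add: power_le_one)
    ultimately have "\<theta>\<^sup>2 * norm (F (\<sigma> * \<theta>)) \<le> 1 * B" by (intro mult_mono) auto
    then show "norm (of_real (\<theta>\<^sup>2) * F (\<sigma> * \<theta>)) \<le> B" by (simp add: norm_mult norm_power)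
  qed (use continuous_on_moment_integrand[OF F \<sigma>] in auto)
  then have "\<sigma> * norm (integral {0..1} (\<lambda>\<theta>. of_real (\<theta>\<^sup>2) * F (\<sigma> * \<theta>))) \<le> 1 * B"
    using \<sigma> by (intro mult_mono) auto
  then show ?thesis using \<sigma> by (simp add: moment_def norm_mult)
qed

lemma continuous_on_moment_param:
  fixes F :: "'a::topological_space \<Rightarrow> real \<Rightarrow> complex"
  assumes "continuous_on (U \<times> {0..1}) (\<lambda>(e, x). F e x)"
  shows "continuous_on (U \<times> {0..1}) (\<lambda>(e, \<sigma>). moment (F e) \<sigma>)"
proof -
  have "continuous_on ((U \<times> {0..1}) \<times> cbox 0 1)
          (\<lambda>(p, \<theta>). of_real (\<theta>\<^sup>2) * F (fst p) (snd p * \<theta>))"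
    unfolding case_prod_unfold
    by (intro continuous_intros continuous_on_compose2[OF assms, of _ "\<lambda>p. (fst (fst p), snd (fst p) * snd p)",
          simplified case_prod_unfold fst_conv snd_conv])
       (auto simp: mult_le_one)
  then have "continuous_on (U \<times> {0..1})
      (\<lambda>p. integral (cbox 0 1) (\<lambda>\<theta>. of_real (\<theta>\<^sup>2) * F (fst p) (snd p * \<theta>)))"
    by (rule integral_continuous_on_param)
  then show ?thesis unfolding moment_def case_prod_unfold
    by (intro continuous_intros) (simp add: cbox_interval)
qed

lemma continuous_on_moment:
  assumes "continuous_on {0..1} F"
  shows "continuous_on {0..1} (moment F)"
proof -
  \<comment> \<open>A one-point parameter set reduces the claim to the parametric version.\<close>
  have "continuous_on ({0::real} \<times> {0..1}) (\<lambda>(e, x). (\<lambda>_. F) e x)"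
    unfolding case_prod_unfold
    by (intro continuous_on_compose2[OF assms]) (auto intro!: continuous_intros)
  from continuous_on_moment_param[OF this]
  have "continuous_on ({0::real} \<times> {0..1}) (\<lambda>p. moment F (snd p))" by (simp add: case_prod_unfold)
  then have "continuous_on {0..1} (\<lambda>x. moment F (snd (0::real, x)))"
    by (rule continuous_on_compose2) (auto intro!: continuous_intros)
  then show ?thesis by simp
qed

section \<open>Square roots near 1 and the contraction property\<close>

lemma Re_csqrt_ge_half:
  fixes m :: complex
  assumes "norm m \<le> 1/8"
  shows "1/2 \<le> Re (csqrt (1 - m))"
proof -
  let ?w = "csqrt (1 - m)"
  have "7/8 \<le> Re (1 - m)" using assms complex_Re_le_cmod[of m] by simp
  also have "Re (1 - m) = Re (?w\<^sup>2)" by simp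
  also have "\<dots> = (Re ?w)\<^sup>2 - (Im ?w)\<^sup>2" by (rule Re_power2)
  also have "\<dots> \<le> (Re ?w)\<^sup>2" by simp
  finally have "(1/2)\<^sup>2 \<le> (Re ?w)\<^sup>2" by (simp add: power2_eq_square)
  then show ?thesis by (rule power2_le_imp_le) (rule Re_csqrt)
qed

text \<open>The difference of the roots times their sum is \<open>m' - m\<close>, and the sum has
  real part at least 1.\<close>

lemma csqrt_lipschitz_near_one:
  fixes m m' :: complex
  assumes "norm m \<le> 1/8" "norm m' \<le> 1/8"
  shows "norm (csqrt (1 - m) - csqrt (1 - m')) \<le> norm (m - m')"
proof -
  let ?w = "csqrt (1 - m)" and ?w' = "csqrt (1 - m')"
  have "1 \<le> Re (?w + ?w')" using Re_csqrt_ge_half[OF assms(1)] Re_csqrt_ge_half[OF assms(2)] by simp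
  also have "\<dots> \<le> norm (?w + ?w')" by (rule complex_Re_le_cmod)
  finally have "norm (?w - ?w') * 1 \<le> norm (?w - ?w') * norm (?w + ?w')"
    by (intro mult_left_mono) auto
  also have "\<dots> = norm ((?w - ?w') * (?w + ?w'))" by (simp add: norm_mult)
  also have "(?w - ?w') * (?w + ?w') = ?w\<^sup>2 - ?w'\<^sup>2" by (simp add: algebra_simps power2_eq_square)
  also have "\<dots> = m' - m" by simp
  finally show ?thesis by (simp add: norm_minus_commute)
qed

lemma near_vertical_norm_le:
  assumes "near_vertical Z" "x \<in> {0..1}"
  shows "norm (Z x) \<le> 3"
proof -
  have "norm (Z x) \<le> norm (Z x - 2 * \<i>) + norm (2 * \<i>)" by (metis diff_add_cancel norm_triangle_ineq)
  then show ?thesis using assms unfolding near_vertical_def by (auto simp: norm_mult dest!: bspec)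
qed

lemma near_vertical_product:
  assumes "small_driver Q" "near_vertical Z"
  shows "continuous_on {0..1} (\<lambda>x. Z x * Q x)"
    and "x \<in> {0..1} \<Longrightarrow> norm (Z x * Q x) \<le> 1/8"
    and "\<sigma> \<in> {0..1} \<Longrightarrow> norm (moment (\<lambda>x. Z x * Q x) \<sigma>) \<le> 1/8"
proof -
  show c: "continuous_on {0..1} (\<lambda>x. Z x * Q x)"
    using assms by (auto simp: small_driver_def near_vertical_def intro!: continuous_intros)
  have b: "norm (Z x * Q x) \<le> 1/8" if "x \<in> {0..1}" for x
  proof -
    have "norm (Z x) * norm (Q x) \<le> 3 * (1/24)"
      using near_vertical_norm_le[OF assms(2) that] assms(1) that
      by (intro mult_mono) (auto simp: small_driver_def)
    then show ?thesis by (simp add: norm_mult)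
  qed
  then show "x \<in> {0..1} \<Longrightarrow> norm (Z x * Q x) \<le> 1/8" .
  show "\<sigma> \<in> {0..1} \<Longrightarrow> norm (moment (\<lambda>x. Z x * Q x) \<sigma>) \<le> 1/8"
    by (rule norm_moment_le[OF c b])
qed

lemma not_nonpos_near_one:
  fixes m :: complex
  assumes "norm m \<le> 1/8"
  shows "1 - m \<notin> \<real>\<^sub>\<le>\<^sub>0"
  using assms complex_Re_le_cmod[of m] by (auto simp: complex_nonpos_Reals_iff)

text \<open>The moment is at most 1/8, so the root is within 1/8 of 1 and the new profile within 1/4
  of \<open>2 * \<i>\<close>.\<close>

lemma near_vertical_step:
  assumes "small_driver Q" "near_vertical Z"
  shows "near_vertical (loewner_step Q Z)"
  unfolding near_vertical_def
proof safe
  note m = near_vertical_product(3)[OF assms]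
  show "continuous_on {0..1} (loewner_step Q Z)"
    unfolding loewner_step_def
  proof (rule continuous_on_mult_left, rule continuous_on_compose2[OF continuous_on_csqrt])
    show "continuous_on {0..1} (\<lambda>\<sigma>. 1 - moment (\<lambda>x. Z x * Q x) \<sigma>)"
      by (intro continuous_on_diff continuous_on_const continuous_on_moment near_vertical_product(1)[OF assms])
  qed (use not_nonpos_near_one[OF m] in auto)
  fix x :: real assume x: "x \<in> {0..1}"
  have "norm (csqrt (1 - moment (\<lambda>x. Z x * Q x) x) - csqrt (1 - 0)) \<le> norm (moment (\<lambda>x. Z x * Q x) x - 0)"
    by (rule csqrt_lipschitz_near_one) (use m[OF x] in auto)
  also have "\<dots> \<le> 1/8" using m[OF x] by simp
  finally have "norm (2 * \<i> * (csqrt (1 - moment (\<lambda>x. Z x * Q x) x) - 1)) \<le> 2 * (1/8)"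
    by (simp add: norm_mult)
  then show "norm (loewner_step Q Z x - 2 * \<i>) \<le> 1"
    by (simp add: loewner_step_def algebra_simps)
qed

text \<open>The integrands differ by \<open>Z (Q - Q') + (Z - Z') Q'\<close>, which yields
  \<open>6 * q + z / 12\<close>. The weaker \<open>z / 2\<close> suffices for geometric series of
  ratio 1/2.\<close>

lemma loewner_step_lipschitz:
  assumes Q: "small_driver Q" and Q': "small_driver Q'"
    and Z: "near_vertical Z" and Z': "near_vertical Z'"
    and q: "\<And>x. x \<in> {0..1} \<Longrightarrow> norm (Q x - Q' x) \<le> q"
    and z: "\<And>x. x \<in> {0..1} \<Longrightarrow> norm (Z x - Z' x) \<le> z"
    and \<sigma>: "\<sigma> \<in> {0..1}"
  shows "norm (loewner_step Q Z \<sigma> - loewner_step Q' Z' \<sigma>) \<le> 6 * q + z / 2"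
proof -
  let ?m = "moment (\<lambda>x. Z x * Q x) \<sigma>" and ?m' = "moment (\<lambda>x. Z' x * Q' x) \<sigma>"
  have z0: "0 \<le> z" by (rule order_trans[OF norm_ge_zero z[OF \<sigma>]])
  have "norm (?m - ?m') \<le> 3 * q + z / 24"
    unfolding moment_diff[OF near_vertical_product(1)[OF Q Z] near_vertical_product(1)[OF Q' Z'] \<sigma>]
  proof (rule norm_moment_le[OF _ _ \<sigma>])
    fix x :: real assume x: "x \<in> {0..1}"
    have "Z x * Q x - Z' x * Q' x = Z x * (Q x - Q' x) + (Z x - Z' x) * Q' x" by (simp add: algebra_simps)
    also have "norm \<dots> \<le> norm (Z x) * norm (Q x - Q' x) + norm (Z x - Z' x) * norm (Q' x)"
      by (metis norm_mult norm_triangle_ineq)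
    also have "\<dots> \<le> 3 * q + z * (1/24)"
    proof (rule add_mono)
      show "norm (Z x) * norm (Q x - Q' x) \<le> 3 * q"
        by (rule mult_mono[OF near_vertical_norm_le[OF Z x] q[OF x]]) simp_all
      have "norm (Q' x) \<le> 1/24" using Q' x unfolding small_driver_def by blast
      then show "norm (Z x - Z' x) * norm (Q' x) \<le> z * (1/24)"
        by (rule mult_mono[OF z[OF x] _ z0]) simp
    qed
    finally show "norm (Z x * Q x - Z' x * Q' x) \<le> 3 * q + z / 24" by simp
  qed (intro continuous_intros near_vertical_product(1) Q Z Q' Z')
  moreover have "norm (csqrt (1 - ?m) - csqrt (1 - ?m')) \<le> norm (?m - ?m')"
    by (intro csqrt_lipschitz_near_one near_vertical_product(3) Q Z Q' Z' \<sigma>)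
  ultimately have "norm (csqrt (1 - ?m) - csqrt (1 - ?m')) \<le> 3 * q + z / 24" by simp
  moreover have "loewner_step Q Z \<sigma> - loewner_step Q' Z' \<sigma> = 2 * \<i> * (csqrt (1 - ?m) - csqrt (1 - ?m'))"
    by (simp add: loewner_step_def algebra_simps)
  ultimately have "norm (loewner_step Q Z \<sigma> - loewner_step Q' Z' \<sigma>) \<le> 2 * (3 * q + z / 24)"
    by (simp add: norm_mult)
  then show ?thesis using z0 by simp
qed

section \<open>Picard iteration and its limit\<close>

lemma loewner_iter_Suc: "loewner_iter Q (Suc k) = loewner_step Q (loewner_iter Q k)"
  by (simp add: loewner_iter_def)

lemma near_vertical_iter:
  assumes "small_driver Q"
  shows "near_vertical (loewner_iter Q k)"
proof (induction k)
  case 0 then show ?case by (auto simp: near_vertical_def loewner_iter_def)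
next
  case (Suc k) then show ?case
    unfolding loewner_iter_Suc by (intro near_vertical_step assms)
qed

text \<open>The value \<open>12 * q\<close> is the fixed point of
  \<open>x \<mapsto> 6 * q + x / 2\<close>, so the induction preserves it for all
  \<open>k\<close>.\<close>

lemma loewner_iter_lipschitz:
  assumes "small_driver Q" "small_driver Q'"
    and q: "\<And>x. x \<in> {0..1} \<Longrightarrow> norm (Q x - Q' x) \<le> q" and "\<sigma> \<in> {0..1}"
  shows "norm (loewner_iter Q k \<sigma> - loewner_iter Q' k \<sigma>) \<le> 12 * q"
  using assms(4)
proof (induction k arbitrary: \<sigma>)
  case 0
  then show ?case using order_trans[OF norm_ge_zero q[OF 0]] by (simp add: loewner_iter_def)
next
  case (Suc k)
  from loewner_step_lipschitz[OF assms(1,2) near_vertical_iter[OF assms(1)] near_vertical_iter[OF assms(2)]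
      q Suc.IH Suc.prems]
  show ?case by (simp add: loewner_iter_Suc)
qed

lemma loewner_iter_step_le:
  assumes "small_driver Q" "\<sigma> \<in> {0..1}"
  shows "norm (loewner_iter Q (Suc k) \<sigma> - loewner_iter Q k \<sigma>) \<le> (1/2) ^ k"
  using assms(2)
proof (induction k arbitrary: \<sigma>)
  case 0
  then show ?case using near_vertical_iter[OF assms(1), of 1]
    by (auto simp: near_vertical_def loewner_iter_def)
next
  case (Suc k)
  from loewner_step_lipschitz[OF assms(1,1) near_vertical_iter[OF assms(1)] near_vertical_iter[OF assms(1)]
      _ Suc.IH Suc.prems, of 0]
  show ?case by (simp add: loewner_iter_Suc)
qed

text \<open>The telescoping series of the iterates is dominated by a geometric one. The explicit
  rate depends on neither \<open>\<sigma>\<close> nor \<open>Q\<close>, which makes convergence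
  uniform in \<open>\<sigma>\<close> and later in a complex parameter.\<close>

lemma loewner_iter_tendsto:
  assumes "small_driver Q" "\<sigma> \<in> {0..1}"
  shows "(\<lambda>k. loewner_iter Q k \<sigma>) \<longlonglongrightarrow> profile Q \<sigma>"
    and "norm (profile Q \<sigma> - loewner_iter Q k \<sigma>) \<le> 2 * (1/2) ^ k"
proof -
  let ?d = "\<lambda>k. loewner_iter Q (Suc k) \<sigma> - loewner_iter Q k \<sigma>"
  have sd: "summable (\<lambda>k. norm (?d k))"
    by (rule summable_comparison_test'[OF summable_geometric[of "1/2::real"], of 0])
       (use loewner_iter_step_le[OF assms] in auto)
  have tel: "(\<Sum>j<k. ?d j) = loewner_iter Q k \<sigma> - loewner_iter Q 0 \<sigma>" for k
    by (rule sum_lessThan_telescope)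
  have "(\<lambda>k. \<Sum>j<k. ?d j) \<longlonglongrightarrow> suminf ?d"
    using summable_norm_cancel[OF sd] by (rule summable_LIMSEQ)
  then have "(\<lambda>k. (loewner_iter Q k \<sigma> - loewner_iter Q 0 \<sigma>) + loewner_iter Q 0 \<sigma>)
      \<longlonglongrightarrow> suminf ?d + loewner_iter Q 0 \<sigma>"
    unfolding tel by (intro tendsto_intros)
  then have "convergent (\<lambda>k. loewner_iter Q k \<sigma>)" by (auto simp: convergent_def)
  then show lim: "(\<lambda>k. loewner_iter Q k \<sigma>) \<longlonglongrightarrow> profile Q \<sigma>"
    unfolding profile_def by (rule convergent_LIMSEQ_iff[THEN iffD1])
  \<comment> \<open>The exact geometric partial sum is kept so that the induction closes; dropping
    the subtracted term gives the tail bound.\<close>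
  have le: "norm (loewner_iter Q (k + l) \<sigma> - loewner_iter Q k \<sigma>) \<le> 2 * (1/2) ^ k - 2 * (1/2) ^ (k + l)" for l
  proof (induction l)
    case (Suc l)
    have "loewner_iter Q (k + Suc l) \<sigma> - loewner_iter Q k \<sigma> = ?d (k + l) + (loewner_iter Q (k + l) \<sigma> - loewner_iter Q k \<sigma>)"
      by simp
    also have "norm \<dots> \<le> (1/2) ^ (k + l) + (2 * (1/2) ^ k - 2 * (1/2) ^ (k + l))"
      by (rule norm_triangle_le[OF add_mono[OF loewner_iter_step_le[OF assms] Suc.IH]])
    finally show ?case by simp
  qed simp
  have "(\<lambda>l. norm (loewner_iter Q (l + k) \<sigma> - loewner_iter Q k \<sigma>)) \<longlonglongrightarrow> norm (profile Q \<sigma> - loewner_iter Q k \<sigma>)"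
    by (intro tendsto_intros LIMSEQ_ignore_initial_segment lim)
  then show "norm (profile Q \<sigma> - loewner_iter Q k \<sigma>) \<le> 2 * (1/2) ^ k"
  proof (rule LIMSEQ_le_const2, intro exI[of _ 0] allI impI)
    fix l
    have "(0::real) \<le> 2 * (1/2) ^ (k + l)" by simp
    then show "norm (loewner_iter Q (l + k) \<sigma> - loewner_iter Q k \<sigma>) \<le> 2 * (1/2) ^ k"
      using le[of l] unfolding add.commute[of l k] by linarith
  qed
qed

lemma near_vertical_profile:
  assumes "small_driver Q"
  shows "near_vertical (profile Q)"
  unfolding near_vertical_def
proof safe
  have "uniform_limit {0..1} (loewner_iter Q) (profile Q) sequentially"
  proof (rule uniform_limitI)
    fix e :: real assume "e > 0"
    have "(\<lambda>k. 2 * (1/2::real) ^ k) \<longlonglongrightarrow> 2 * 0" by (intro tendsto_intros) auto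
    then have "\<forall>\<^sub>F k in sequentially. 2 * (1/2::real) ^ k < e"
      using \<open>e > 0\<close> by (intro order_tendstoD) auto
    then show "\<forall>\<^sub>F k in sequentially. \<forall>x\<in>{0..1}. dist (loewner_iter Q k x) (profile Q x) < e"
    proof (rule eventually_mono, intro ballI)
      fix k and x :: real assume "2 * (1/2::real) ^ k < e" "x \<in> {0..1}"
      then show "dist (loewner_iter Q k x) (profile Q x) < e"
        using loewner_iter_tendsto(2)[OF assms, of x k] by (simp add: dist_commute dist_norm)
    qed
  qed
  then show "continuous_on {0..1} (profile Q)"
    by (rule uniform_limit_theorem[rotated])
       (use near_vertical_iter[OF assms] in \<open>auto simp: near_vertical_def\<close>)
  fix x :: real assume x: "x \<in> {0..1}"
  show "norm (profile Q x - 2 * \<i>) \<le> 1"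
    by (rule Lim_norm_ubound[OF _ tendsto_diff[OF loewner_iter_tendsto(1)[OF assms x] tendsto_const]])
       (use near_vertical_iter[OF assms] x in \<open>auto simp: near_vertical_def\<close>)
qed

text \<open>One step halves the bound \<open>2 * (1/2) ^ k\<close> on the distance from
  \<open>profile Q\<close> to the iterate, so the iterates also converge to the image of
  \<open>profile Q\<close>.\<close>

lemma profile_fixed_point:
  assumes "small_driver Q" "\<sigma> \<in> {0..1}"
  shows "loewner_step Q (profile Q) \<sigma> = profile Q \<sigma>"
proof -
  have "norm (loewner_step Q (profile Q) \<sigma> - loewner_iter Q (Suc k) \<sigma>) \<le> (1/2) ^ k" for k
    using loewner_step_lipschitz[OF assms(1,1) near_vertical_profile[OF assms(1)] near_vertical_iter[OF assms(1)]
      _ loewner_iter_tendsto(2)[OF assms(1)] assms(2), of 0 k]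
    by (simp add: loewner_iter_Suc)
  then have "(\<lambda>k. loewner_iter Q (Suc k) \<sigma>) \<longlonglongrightarrow> loewner_step Q (profile Q) \<sigma>"
    by (intro Lim_transform_bound[of "\<lambda>k. loewner_iter Q (Suc k) \<sigma> - loewner_step Q (profile Q) \<sigma>"
          "\<lambda>k. (1/2::real) ^ k", THEN LIM_zero_cancel])
       (auto simp: norm_minus_commute intro!: LIMSEQ_power_zero always_eventually)
  moreover have "(\<lambda>k. loewner_iter Q (Suc k) \<sigma>) \<longlonglongrightarrow> profile Q \<sigma>"
    by (rule LIMSEQ_Suc[OF loewner_iter_tendsto(1)[OF assms]])
  ultimately show ?thesis by (rule LIMSEQ_unique)
qed

text \<open>This stability estimate serves three comparisons of drivers: continuity in
  \<open>t\<close>, replacement of the derivative by its Taylor polynomial, and locality of the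
  coefficients.\<close>

lemma profile_lipschitz:
  assumes "small_driver Q" "small_driver Q'"
    and "\<And>x. x \<in> {0..1} \<Longrightarrow> norm (Q x - Q' x) \<le> q" and "\<sigma> \<in> {0..1}"
  shows "norm (profile Q \<sigma> - profile Q' \<sigma>) \<le> 12 * q"
  by (rule Lim_norm_ubound[OF _ tendsto_diff[OF loewner_iter_tendsto(1)[OF assms(1,4)]
          loewner_iter_tendsto(1)[OF assms(2,4)]]])
     (use loewner_iter_lipschitz[OF assms] in auto)

section \<open>The swallowed point and the curve\<close>

text \<open>The substitution \<open>x = \<sigma> \<theta>\<close> recovers the plain primitive,
  which can be differentiated in its upper limit.\<close>

lemma moment_eq_primitive:
  assumes F: "continuous_on {0..1} F" and \<sigma>: "\<sigma> \<in> {0<..1}"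
  shows "of_real (\<sigma>\<^sup>2) * moment F \<sigma> = integral {0..\<sigma>} (\<lambda>x. of_real (x\<^sup>2) * F x)"
proof -
  let ?f = "\<lambda>x. of_real (x\<^sup>2) * F x"
  have "continuous_on {0..\<sigma>} ?f"
    using \<sigma> by (intro continuous_intros continuous_on_subset[OF F]) auto
  then have "(?f has_integral integral {0..\<sigma>} ?f) (cbox 0 \<sigma>)"
    unfolding cbox_interval by (intro integrable_integral integrable_continuous_real)
  from has_integral_affinity[OF this, of \<sigma> 0]
  have "((\<lambda>x. ?f (\<sigma> * x)) has_integral (1 / \<sigma>) *\<^sub>R integral {0..\<sigma>} ?f) ((\<lambda>x. x / \<sigma>) ` {0..\<sigma>})"
    using \<sigma> by simp
  also have "(\<lambda>x. x / \<sigma>) ` {0..\<sigma>} = {0..1}"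
    using image_divide_atLeastAtMost[of \<sigma> 0 \<sigma>] \<sigma> by simp
  finally have "integral {0..1} (\<lambda>x. ?f (\<sigma> * x)) = (1 / \<sigma>) *\<^sub>R integral {0..\<sigma>} ?f"
    by (rule integral_unique)
  moreover have "(\<lambda>x. ?f (\<sigma> * x)) = (\<lambda>x. of_real (\<sigma>\<^sup>2) * (of_real (x\<^sup>2) * F (\<sigma> * x)))"
    by (simp add: power_mult_distrib mult_ac)
  ultimately have "of_real (\<sigma>\<^sup>2) * integral {0..1} (\<lambda>x. of_real (x\<^sup>2) * F (\<sigma> * x)) = (1 / \<sigma>) *\<^sub>R integral {0..\<sigma>} ?f"
    by simp
  then have "of_real \<sigma> * (of_real (\<sigma>\<^sup>2) * integral {0..1} (\<lambda>x. of_real (x\<^sup>2) * F (\<sigma> * x)))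
      = of_real \<sigma> * ((1 / \<sigma>) *\<^sub>R integral {0..\<sigma>} ?f)"
    by (rule arg_cong)
  then show ?thesis using \<sigma> by (simp add: moment_def scaleR_conv_of_real mult_ac)
qed

text \<open>Two solutions satisfy \<open>(g - h)' = - p (g - h)\<close>. The integrating factor
  makes \<open>E\<close> constant, and \<open>E\<close> vanishes at 0.\<close>

lemma loewner_flow_unique:
  fixes g h :: "real \<Rightarrow> complex" and lam :: "real \<Rightarrow> real"
  assumes lam: "continuous_on {0..t} lam" and eq0: "g 0 = h 0"
    and g: "\<And>s. s \<in> {0..t} \<Longrightarrow> g s \<noteq> lam s \<and>
        (g has_vector_derivative 2 / (g s - of_real (lam s))) (at s within {0..t})"
    and h: "\<And>s. s \<in> {0..t} \<Longrightarrow> h s \<noteq> lam s \<and>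
        (h has_vector_derivative 2 / (h s - of_real (lam s))) (at s within {0..t})"
    and s: "s \<in> {0..t}"
  shows "g s = h s"
proof -
  define p where "p s = 2 / ((g s - lam s) * (h s - lam s))" for s
  define E where "E s = (g s - h s) * exp (integral {0..s} p)" for s
  have cg: "continuous_on {0..t} g"
    by (rule continuous_on_vector_derivative) (use g in blast)
  have ch: "continuous_on {0..t} h"
    by (rule continuous_on_vector_derivative) (use h in blast)
  have p: "continuous_on {0..t} p"
    unfolding p_def by (intro continuous_intros cg ch lam) (use g h in auto)
  have "(E has_vector_derivative 0) (at s within {0..t})" if s: "s \<in> {0..t}" for s
  proof -
    have "((\<lambda>s. exp (integral {0..s} p)) has_vector_derivative p s * exp (integral {0..s} p)) (at s within {0..t})"
      using field_vector_diff_chain_within[OF integral_has_vector_derivative[OF p s] DERIV_exp[THEN has_field_derivative_at_within]]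
      by (simp add: o_def)
    then have "(E has_vector_derivative
        (g s - h s) * (p s * exp (integral {0..s} p)) +
        (2 / (g s - lam s) - 2 / (h s - lam s)) * exp (integral {0..s} p)) (at s within {0..t})"
      unfolding E_def using g[OF s] h[OF s]
      by (intro has_vector_derivative_mult has_vector_derivative_diff) auto
    moreover have "(g s - h s) * p s + (2 / (g s - lam s) - 2 / (h s - lam s)) = 0"
      using g[OF s] h[OF s] unfolding p_def by (simp add: divide_simps)
    then have "(g s - h s) * (p s * exp (integral {0..s} p)) +
        (2 / (g s - lam s) - 2 / (h s - lam s)) * exp (integral {0..s} p) = 0"
      by (metis (no_types, lifting) distrib_right mult.assoc mult_zero_left)
    ultimately show ?thesis by simp
  qed
  then obtain c where c: "\<And>s. s \<in> {0..t} \<Longrightarrow> E s = c"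
    using has_vector_derivative_zero_constant[of "{0..t}" E] by auto
  have "E 0 = 0" by (simp add: E_def eq0)
  then have "E s = 0" using c[OF s] c[of 0] s by auto
  then show ?thesis by (simp add: E_def)
qed

section \<open>The backward flow and its swallowed starting point\<close>

definition rescaled_driver :: "(real \<Rightarrow> real) \<Rightarrow> real \<Rightarrow> real \<Rightarrow> complex" where
  "rescaled_driver \<kappa> t \<sigma> = of_real (sqrt t * \<kappa> (t * (1 - \<sigma>\<^sup>2)))"

definition tip :: "(real \<Rightarrow> real) \<Rightarrow> real \<Rightarrow> complex" where
  "tip \<kappa> t = of_real (sqrt t) * profile (rescaled_driver \<kappa> t) 1"

text \<open>The backward flow read in forward time: \<open>u = t - s\<close> corresponds to
  \<open>\<sigma> = sqrt (1 - s / t)\<close>. It represents \<open>g s - lam s\<close> along the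
  trajectory starting at the tip, and it reaches 0 at \<open>s = t\<close>.\<close>

definition tip_flow :: "(real \<Rightarrow> real) \<Rightarrow> real \<Rightarrow> real \<Rightarrow> complex" where
  "tip_flow \<kappa> t s = of_real (sqrt t * sqrt (1 - s / t)) * profile (rescaled_driver \<kappa> t) (sqrt (1 - s / t))"

text \<open>Here \<open>\<kappa>\<close> is the derivative of \<open>lam\<close>. Using
  \<open>sqrt t0\<close> in the bound makes the rescaled driver small for every \<open>t\<close> up
  to \<open>t0\<close> at once.\<close>

definition small_loewner_driver :: "(real \<Rightarrow> real) \<Rightarrow> (real \<Rightarrow> real) \<Rightarrow> real \<Rightarrow> bool" where
  "small_loewner_driver lam \<kappa> t0 \<longleftrightarrow> t0 > 0 \<and> continuous_on {0..t0} \<kappa> \<and>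
     (\<forall>s\<in>{0..t0}. (lam has_real_derivative \<kappa> s) (at s within {0..t0})) \<and>
     lam 0 = 0 \<and> (\<forall>s\<in>{0..t0}. sqrt t0 * \<bar>\<kappa> s\<bar> \<le> 1/24)"

lemma small_loewner_driverD:
  assumes "small_loewner_driver lam \<kappa> t0"
  shows "t0 > 0" and "continuous_on {0..t0} \<kappa>"
    and "\<And>s. s \<in> {0..t0} \<Longrightarrow> (lam has_real_derivative \<kappa> s) (at s within {0..t0})"
    and "lam 0 = 0" and "\<And>s. s \<in> {0..t0} \<Longrightarrow> sqrt t0 * \<bar>\<kappa> s\<bar> \<le> 1/24"
  using assms unfolding small_loewner_driver_def by blast+

lemma rescaled_time:
  assumes L: "small_loewner_driver lam \<kappa> t0"
    and "t \<in> {0..t0}" "\<sigma> \<in> {0..1}"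
  shows "t * (1 - \<sigma>\<^sup>2) \<in> {0..t0}"
proof -
  have "0 \<le> 1 - \<sigma>\<^sup>2" "1 - \<sigma>\<^sup>2 \<le> 1" using assms by (auto simp: power_le_one)
  then have "t * (1 - \<sigma>\<^sup>2) \<le> t0 * 1" "0 \<le> t * (1 - \<sigma>\<^sup>2)"
    using assms by (auto intro!: mult_mono mult_nonneg_nonneg simp del: mult_1_right)
  then show ?thesis by auto
qed

lemma small_rescaled_driver:
  assumes L: "small_loewner_driver lam \<kappa> t0"
    and t: "t \<in> {0..t0}"
  shows "small_driver (rescaled_driver \<kappa> t)"
  unfolding small_driver_def
proof safe
  show "continuous_on {0..1} (rescaled_driver \<kappa> t)"
    unfolding rescaled_driver_def
  proof (rule continuous_on_of_real, rule continuous_on_mult_left)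
    show "continuous_on {0..1} (\<lambda>\<sigma>. \<kappa> (t * (1 - \<sigma>\<^sup>2)))"
      by (rule continuous_on_compose2[OF small_loewner_driverD(2)[OF L], of _ "\<lambda>\<sigma>. t * (1 - \<sigma>\<^sup>2)"])
         (intro continuous_intros image_subsetI rescaled_time[OF L t])+
  qed
  fix \<sigma> :: real assume "\<sigma> \<in> {0..1}"
  from rescaled_time[OF L t this] have "sqrt t0 * \<bar>\<kappa> (t * (1 - \<sigma>\<^sup>2))\<bar> \<le> 1/24" by (rule small_loewner_driverD(5)[OF L])
  moreover have "sqrt t * \<bar>\<kappa> (t * (1 - \<sigma>\<^sup>2))\<bar> \<le> sqrt t0 * \<bar>\<kappa> (t * (1 - \<sigma>\<^sup>2))\<bar>"
    using t by (intro mult_right_mono) auto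
  ultimately show "norm (rescaled_driver \<kappa> t \<sigma>) \<le> 1/24"
    using t by (simp add: rescaled_driver_def norm_mult)
qed

lemma Im_profile_ge_1:
  assumes L: "small_loewner_driver lam \<kappa> t0"
    and "t \<in> {0..t0}" "\<sigma> \<in> {0..1}"
  shows "1 \<le> Im (profile (rescaled_driver \<kappa> t) \<sigma>)"
proof -
  have "norm (profile (rescaled_driver \<kappa> t) \<sigma> - 2 * \<i>) \<le> 1"
    using near_vertical_profile[OF small_rescaled_driver[OF L assms(2)]] assms(3)
    by (auto simp: near_vertical_def)
  then have "\<bar>Im (profile (rescaled_driver \<kappa> t) \<sigma> - 2 * \<i>)\<bar> \<le> 1"
    using abs_Im_le_cmod order_trans by blast
  then show ?thesis by simp
qed

lemma Im_tip_pos: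
  assumes L: "small_loewner_driver lam \<kappa> t0"
    and "t \<in> {0<..t0}"
  shows "0 < Im (tip \<kappa> t)"
  using Im_profile_ge_1[OF L, of t 1] assms by (simp add: tip_def)

lemma Im_tip_flow_pos:
  assumes L: "small_loewner_driver lam \<kappa> t0"
    and "t \<in> {0<..t0}" "s \<in> {0..<t}"
  shows "0 < Im (tip_flow \<kappa> t s)"
  using Im_profile_ge_1[OF L, of t "sqrt (1 - s / t)"] assms by (simp add: tip_flow_def)

text \<open>Clearing the denominator hidden in the moment turns the flow into the root of an
  expression that can be differentiated in \<open>s\<close>. The squares agree, and positive real
  part identifies the principal root.\<close>

lemma tip_flow_eq_csqrt:
  assumes L: "small_loewner_driver lam \<kappa> t0"
    and t: "t \<in> {0<..t0}" and s: "s \<in> {0..<t}"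
  shows "tip_flow \<kappa> t s = \<i> * csqrt (of_real (4 * t * (1 - s / t)) - of_real (4 * t) *
    integral {0..sqrt (1 - s / t)} (\<lambda>x. of_real (x\<^sup>2) * (profile (rescaled_driver \<kappa> t) x * rescaled_driver \<kappa> t x)))"
    (is "_ = \<i> * csqrt ?W")
proof -
  let ?Z = "profile (rescaled_driver \<kappa> t)" and ?\<sigma> = "sqrt (1 - s / t)"
  have \<sigma>: "?\<sigma> \<in> {0<..1}" using t s by auto
  have \<sigma>2: "?\<sigma>\<^sup>2 = 1 - s / t" using \<sigma> by simp
  have sm: "small_driver (rescaled_driver \<kappa> t)" using t by (intro small_rescaled_driver[OF L]) auto
  note nv = near_vertical_product[OF sm near_vertical_profile[OF sm]]
  let ?m = "moment (\<lambda>x. ?Z x * rescaled_driver \<kappa> t x) ?\<sigma>"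
  have m: "norm ?m \<le> 1/8" by (rule nv(3)) (use \<sigma> in auto)
  let ?w = "of_real (2 * sqrt t * ?\<sigma>) * csqrt (1 - ?m)"
  have "?w\<^sup>2 = of_real ((2 * sqrt t * ?\<sigma>)\<^sup>2) * (csqrt (1 - ?m))\<^sup>2" by (simp add: power_mult_distrib)
  also have "(2 * sqrt t * ?\<sigma>)\<^sup>2 = 4 * t * ?\<sigma>\<^sup>2" using t by (simp add: power_mult_distrib del: real_sqrt_pow2_iff)
  also have "of_real (4 * t * ?\<sigma>\<^sup>2) * (csqrt (1 - ?m))\<^sup>2 = of_real (4 * t * ?\<sigma>\<^sup>2) - of_real (4 * t) * (of_real (?\<sigma>\<^sup>2) * ?m)"
    by (simp only: power2_csqrt of_real_mult) (simp add: algebra_simps)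
  also have "\<dots> = ?W" unfolding moment_eq_primitive[OF nv(1) \<sigma>] unfolding \<sigma>2 ..
  finally have "?w\<^sup>2 = ?W" .
  moreover have "0 < Re ?w"
    using Re_csqrt_ge_half[OF m] \<sigma> t by (simp del: csqrt.simps)
  ultimately have "csqrt ?W = ?w" by (intro csqrt_unique disjI1)
  moreover have "?Z ?\<sigma> = 2 * \<i> * csqrt (1 - ?m)"
    using profile_fixed_point[OF sm, of ?\<sigma>] \<sigma> by (simp add: loewner_step_def)
  ultimately show ?thesis by (simp add: tip_flow_def)
qed

text \<open>With the radicand \<open>W\<close> one has
  \<open>W' = -4 + 2 * tip_flow * \<kappa>\<close>, and the chain rule for
  \<open>\<i> * csqrt W\<close> gives the equation. Staying below \<open>u < t\<close> avoids the
  singular point \<open>\<sigma> = 0\<close>.\<close>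

lemma tip_flow_has_derivative:
  assumes L: "small_loewner_driver lam \<kappa> t0"
    and t: "t \<in> {0<..t0}" and u: "u < t" and s: "s \<in> {0..u}"
  shows "(tip_flow \<kappa> t has_vector_derivative 2 / tip_flow \<kappa> t s - of_real (\<kappa> s)) (at s within {0..u})"
proof -
  let ?Z = "profile (rescaled_driver \<kappa> t)" and ?\<sigma> = "\<lambda>s. sqrt (1 - s / t)"
  let ?F = "\<lambda>x. of_real (x\<^sup>2) * (?Z x * rescaled_driver \<kappa> t x)"
  define W where "W s = of_real (4 * t * (1 - s / t)) - of_real (4 * t) * integral {0..?\<sigma> s} ?F" for s
  have \<sigma>: "?\<sigma> s \<in> {0<..1}" "?\<sigma> ` {0..u} \<subseteq> {0..1}" using t u s by auto
  have \<sigma>2: "(?\<sigma> s)\<^sup>2 = 1 - s / t" using \<sigma> by simp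
  have sm: "small_driver (rescaled_driver \<kappa> t)" using t by (intro small_rescaled_driver[OF L]) auto
  have F: "continuous_on {0..1} ?F"
    by (intro continuous_intros near_vertical_product(1)[OF sm near_vertical_profile[OF sm]])
  have h: "tip_flow \<kappa> t r = \<i> * csqrt (W r)" if "r \<in> {0..u}" for r
    unfolding W_def by (rule tip_flow_eq_csqrt[OF L t]) (use that u in auto)
  have Im_h: "0 < Im (tip_flow \<kappa> t s)" by (rule Im_tip_flow_pos[OF L t]) (use u s in auto)
  have ne: "tip_flow \<kappa> t s \<noteq> 0" using Im_h by auto
  \<comment> \<open>On the cut the principal root is purely imaginary, so \<open>\<i>\<close> times
    it would be real, whereas the flow has positive imaginary part.\<close>
  have W: "W s \<notin> \<real>\<^sub>\<le>\<^sub>0"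
  proof
    assume "W s \<in> \<real>\<^sub>\<le>\<^sub>0"
    then have "Re (csqrt (W s)) = 0" by (auto elim!: nonpos_Reals_cases simp: csqrt_of_real_nonpos)
    then show False using Im_h h[OF s] by simp
  qed
  have "(?\<sigma> has_real_derivative - 1 / (2 * t * ?\<sigma> s)) (at s within {0..u})"
    using \<sigma> t by (auto intro!: derivative_eq_intros simp: divide_simps)
  then have d\<sigma>: "(?\<sigma> has_vector_derivative - 1 / (2 * t * ?\<sigma> s)) (at s within {0..u})"
    by (simp add: has_real_derivative_iff_has_vector_derivative)
  have dF: "((\<lambda>x. integral {0..x} ?F) has_vector_derivative ?F (?\<sigma> s)) (at (?\<sigma> s) within ?\<sigma> ` {0..u})"
    by (rule has_vector_derivative_within_subset[OF integral_has_vector_derivative[OF F] \<sigma>(2)])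
       (use \<sigma>(1) in auto)
  have dI: "((\<lambda>s. integral {0..?\<sigma> s} ?F) has_vector_derivative (- 1 / (2 * t * ?\<sigma> s)) *\<^sub>R ?F (?\<sigma> s)) (at s within {0..u})"
    using vector_diff_chain_within[OF d\<sigma> dF] by (simp add: o_def)
  have dl: "((\<lambda>s. complex_of_real (4 * t * (1 - s / t))) has_vector_derivative of_real (-4)) (at s within {0..u})"
    using t by (intro has_vector_derivative_of_real)
      (auto intro!: derivative_eq_intros simp: has_real_derivative_iff_has_vector_derivative[symmetric])
  have "(W has_vector_derivative of_real (-4) - of_real (4 * t) * ((- 1 / (2 * t * ?\<sigma> s)) *\<^sub>R ?F (?\<sigma> s))) (at s within {0..u})"
    unfolding W_def by (intro has_vector_derivative_diff dl has_vector_derivative_mult_right dI)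
  also have "of_real (4 * t) * ((- 1 / (2 * t * ?\<sigma> s)) *\<^sub>R ?F (?\<sigma> s)) = - (2 * of_real (?\<sigma> s) * (?Z (?\<sigma> s) * rescaled_driver \<kappa> t (?\<sigma> s)))"
  proof -
    have "4 * t * ((- 1 / (2 * t * x)) * x\<^sup>2) = - (2 * x)" if "x > 0" for x
      using that t by (simp add: power2_eq_square)
    from this[of "?\<sigma> s"] \<sigma>(1)
    have "4 * t * ((- 1 / (2 * t * ?\<sigma> s)) * (?\<sigma> s)\<^sup>2) = - (2 * ?\<sigma> s)" by auto
    then have "of_real (4 * t * ((- 1 / (2 * t * ?\<sigma> s)) * (?\<sigma> s)\<^sup>2)) * X = - (2 * of_real (?\<sigma> s) * X)" for X :: complex
      by (simp only: of_real_minus of_real_mult) simp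
    then show ?thesis by (simp only: scaleR_conv_of_real of_real_mult mult.assoc)
  qed
  \<comment> \<open>Here \<open>t * (1 - \<sigma>^2) = s\<close>, and the factor
    \<open>sqrt t\<close> of the driver is absorbed into \<open>tip_flow\<close>.\<close>
  also have "2 * of_real (?\<sigma> s) * (?Z (?\<sigma> s) * rescaled_driver \<kappa> t (?\<sigma> s)) = 2 * (tip_flow \<kappa> t s * of_real (\<kappa> s))"
    using t by (simp add: tip_flow_def rescaled_driver_def \<sigma>2)
  finally have dW: "(W has_vector_derivative -4 + 2 * (tip_flow \<kappa> t s * of_real (\<kappa> s))) (at s within {0..u})"
    by simp
  have "((\<lambda>s. \<i> * csqrt (W s)) has_vector_derivative
      \<i> * ((-4 + 2 * (tip_flow \<kappa> t s * of_real (\<kappa> s))) * inverse (2 * csqrt (W s)))) (at s within {0..u})"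
    using field_vector_diff_chain_within[OF dW has_field_derivative_csqrt[OF W, THEN has_field_derivative_at_within]]
    by (intro has_vector_derivative_mult_right) (simp add: o_def)
  then have "(tip_flow \<kappa> t has_vector_derivative
      \<i> * ((-4 + 2 * (tip_flow \<kappa> t s * of_real (\<kappa> s))) * inverse (2 * csqrt (W s)))) (at s within {0..u})"
    by (rule has_vector_derivative_transform[OF s, rotated]) (simp add: h)
  moreover have "csqrt (W s) = - \<i> * tip_flow \<kappa> t s" using h[OF s] by simp
  then have "\<i> * ((-4 + 2 * (tip_flow \<kappa> t s * of_real (\<kappa> s))) * inverse (2 * csqrt (W s)))
      = 2 / tip_flow \<kappa> t s - of_real (\<kappa> s)"
    using ne by (simp add: field_simps)
  ultimately show ?thesis by (simp only:)
qed

lemma continuous_on_lam: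
  assumes L: "small_loewner_driver lam \<kappa> t0"
  shows "t \<le> t0 \<Longrightarrow> continuous_on {0..t} lam"
  by (rule continuous_on_subset[of "{0..t0}"])
     (auto intro!: DERIV_continuous_on[OF small_loewner_driverD(3)[OF L]])

lemma shifted_tip_flow_solves:
  assumes L: "small_loewner_driver lam \<kappa> t0"
    and t: "t \<in> {0<..t0}" and u: "u < t" and s: "s \<in> {0..u}"
  shows "tip_flow \<kappa> t s + lam s \<noteq> lam s \<and>
    ((\<lambda>s. tip_flow \<kappa> t s + lam s) has_vector_derivative
      2 / (tip_flow \<kappa> t s + lam s - of_real (lam s))) (at s within {0..u})"
proof -
  have ne: "tip_flow \<kappa> t s \<noteq> 0" using Im_tip_flow_pos[OF L t, of s] u s by auto
  have "(lam has_real_derivative \<kappa> s) (at s within {0..u})"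
    by (rule DERIV_subset[OF small_loewner_driverD(3)[OF L]]) (use t u s in auto)
  then have "((\<lambda>s. tip_flow \<kappa> t s + lam s) has_vector_derivative
      (2 / tip_flow \<kappa> t s - of_real (\<kappa> s)) + of_real (\<kappa> s)) (at s within {0..u})"
    by (intro has_vector_derivative_add tip_flow_has_derivative[OF L t u s] has_vector_derivative_of_real)
       (simp add: has_real_derivative_iff_has_vector_derivative)
  then show ?thesis using ne by simp
qed

lemma tip_flow_0:
  assumes L: "small_loewner_driver lam \<kappa> t0"
  shows "t > 0 \<Longrightarrow> tip_flow \<kappa> t 0 + lam 0 = tip \<kappa> t"
  by (simp add: tip_flow_def tip_def small_loewner_driverD(4)[OF L])

lemma tip_notin_hull:
  assumes L: "small_loewner_driver lam \<kappa> t0"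
    and t: "t \<in> {0<..t0}" and u: "0 \<le> u" "u < t"
  shows "tip \<kappa> t \<notin> loewner_hull lam u"
proof -
  have "t > 0" using t by simp
  from tip_flow_0[OF L this] shifted_tip_flow_solves[OF L t u(2)]
  have "\<exists>g. g 0 = tip \<kappa> t \<and> (\<forall>s\<in>{0..u}. g s \<noteq> complex_of_real (lam s) \<and>
      (g has_vector_derivative 2 / (g s - complex_of_real (lam s))) (at s within {0..u}))"
    by (intro exI[of _ "\<lambda>s. tip_flow \<kappa> t s + lam s"]) blast
  then show ?thesis unfolding loewner_hull_def by blast
qed

lemma tip_flow_tendsto_0:
  assumes L: "small_loewner_driver lam \<kappa> t0"
    and t: "t \<in> {0<..t0}"
  shows "(tip_flow \<kappa> t \<longlongrightarrow> 0) (at_left t)"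
proof (rule Lim_null_comparison)
  have "\<forall>\<^sub>F s in at_left t. s \<in> {0<..<t}"
    using t by (intro eventually_at_leftI[of 0]) auto
  then show "\<forall>\<^sub>F s in at_left t. norm (tip_flow \<kappa> t s) \<le> sqrt t * sqrt (1 - s / t) * 3"
  proof eventually_elim
    case (elim s)
    have "norm (profile (rescaled_driver \<kappa> t) (sqrt (1 - s / t))) \<le> 3"
      by (intro near_vertical_norm_le near_vertical_profile small_rescaled_driver[OF L]) (use t elim in auto)
    then show ?case using t elim
      by (auto simp: tip_flow_def norm_mult intro!: mult_left_mono)
  qed
  have "((\<lambda>s. sqrt t * sqrt (1 - s / t) * 3) \<longlongrightarrow> sqrt t * sqrt (1 - t / t) * 3) (at_left t)"
    using t by (intro tendsto_intros) auto
  moreover have "sqrt t * sqrt (1 - t / t) * 3 = 0" using t by simp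
  ultimately show "((\<lambda>s. sqrt t * sqrt (1 - s / t) * 3) \<longlongrightarrow> 0) (at_left t)" by (simp only:)
qed

text \<open>A solution surviving to time \<open>t\<close> would agree with the shifted tip flow
  before \<open>t\<close>, so its distance to \<open>lam\<close> would tend to 0; continuity would
  then force \<open>g t = lam t\<close>.\<close>

lemma tip_in_hull:
  assumes L: "small_loewner_driver lam \<kappa> t0"
    and t: "t \<in> {0<..t0}"
  shows "tip \<kappa> t \<in> loewner_hull lam t"
proof (rule ccontr)
  assume "tip \<kappa> t \<notin> loewner_hull lam t"
  then obtain g where g0: "g 0 = tip \<kappa> t" and g: "\<And>s. s \<in> {0..t} \<Longrightarrow> g s \<noteq> lam s \<and>
      (g has_vector_derivative 2 / (g s - of_real (lam s))) (at s within {0..t})"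
    using Im_tip_pos[OF L t] unfolding loewner_hull_def upper_half_plane_def by blast
  have eq: "g s = tip_flow \<kappa> t s + lam s" if s: "s \<in> {0..<t}" for s
  proof (rule loewner_flow_unique[where t = s and h = "\<lambda>s. tip_flow \<kappa> t s + lam s"])
    show "continuous_on {0..s} lam" using t s by (intro continuous_on_lam[OF L]) auto
    show "g 0 = tip_flow \<kappa> t 0 + lam 0" using g0 tip_flow_0[OF L] t by simp
    show "g r \<noteq> lam r \<and> (g has_vector_derivative 2 / (g r - of_real (lam r))) (at r within {0..s})"
      if "r \<in> {0..s}" for r
    proof -
      have r: "r \<in> {0..t}" and sub: "{0..s} \<subseteq> {0..t}" using that s by auto
      then show ?thesis using g[OF r] has_vector_derivative_within_subset[OF _ sub] by blast
    qed
    show "tip_flow \<kappa> t r + lam r \<noteq> lam r \<and> ((\<lambda>s. tip_flow \<kappa> t s + lam s) has_vector_derivative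
      2 / (tip_flow \<kappa> t r + lam r - of_real (lam r))) (at r within {0..s})" if "r \<in> {0..s}" for r
      by (rule shifted_tip_flow_solves[OF L t]) (use s that in auto)
    show "s \<in> {0..s}" using s by auto
  qed
  have "continuous_on {0..t} g"
    by (rule continuous_on_vector_derivative) (use g in blast)
  then have "(g \<longlongrightarrow> g t) (at_left t)" "(lam \<longlongrightarrow> lam t) (at_left t)"
    using t continuous_on_lam[OF L, of t] by (auto simp: continuous_on_Icc_at_leftD)
  then have "((\<lambda>s. g s - lam s) \<longlongrightarrow> g t - lam t) (at_left t)" by (intro tendsto_intros)
  moreover have "((\<lambda>s. g s - lam s) \<longlongrightarrow> 0) (at_left t)"
  proof (rule Lim_transform_eventually[OF tip_flow_tendsto_0[OF L t]])
    have "\<forall>\<^sub>F s in at_left t. s \<in> {0<..<t}"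
      using t by (intro eventually_at_leftI[of 0]) auto
    then show "\<forall>\<^sub>F s in at_left t. tip_flow \<kappa> t s = g s - lam s"
      by (rule eventually_mono) (simp add: eq)
  qed
  ultimately have "g t - lam t = 0" by (rule tendsto_unique[rotated]) simp
  then show False using g[of t] t by auto
qed

text \<open>The Lipschitz bound reduces this to uniform continuity of the driver on a compact
  rectangle; \<open>e / 24\<close> becomes \<open>e / 2\<close> after the factor 12.\<close>

lemma continuous_on_tip:
  assumes L: "small_loewner_driver lam \<kappa> t0"
  shows "continuous_on {0..t0} (tip \<kappa>)"
proof -
  have cQ: "continuous_on ({0..t0} \<times> {0..1}) (\<lambda>(t, \<sigma>). rescaled_driver \<kappa> t \<sigma>)"
    unfolding rescaled_driver_def case_prod_unfold
    by (intro continuous_intros continuous_on_compose2[OF small_loewner_driverD(2)[OF L]])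
       (use rescaled_time[OF L] in auto)
  have "continuous_on {0..t0} (\<lambda>t. profile (rescaled_driver \<kappa> t) 1)"
    unfolding continuous_on_iff
  proof (intro ballI allI impI)
    fix t e :: real assume t: "t \<in> {0..t0}" and e: "e > 0"
    have "uniformly_continuous_on ({0..t0} \<times> {0..1}) (\<lambda>(t, \<sigma>). rescaled_driver \<kappa> t \<sigma>)"
      by (intro compact_uniformly_continuous cQ compact_Times) auto
    then obtain d where d: "d > 0" and
      D: "\<And>p q. p \<in> {0..t0} \<times> {0..1} \<Longrightarrow> q \<in> {0..t0} \<times> {0..1} \<Longrightarrow> dist q p < d \<Longrightarrow>
         dist (case q of (t, \<sigma>) \<Rightarrow> rescaled_driver \<kappa> t \<sigma>) (case p of (t, \<sigma>) \<Rightarrow> rescaled_driver \<kappa> t \<sigma>) < e / 24"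
      unfolding uniformly_continuous_on_def using e by (metis (lifting) divide_pos_pos zero_less_numeral)
    show "\<exists>d>0. \<forall>t'\<in>{0..t0}. dist t' t < d \<longrightarrow>
        dist (profile (rescaled_driver \<kappa> t') 1) (profile (rescaled_driver \<kappa> t) 1) < e"
    proof (intro exI[of _ d] conjI d ballI impI)
      fix t' assume t': "t' \<in> {0..t0}" "dist t' t < d"
      have "norm (profile (rescaled_driver \<kappa> t') 1 - profile (rescaled_driver \<kappa> t) 1) \<le> 12 * (e / 24)"
      proof (rule profile_lipschitz)
        fix x :: real assume x: "x \<in> {0..1}"
        show "norm (rescaled_driver \<kappa> t' x - rescaled_driver \<kappa> t x) \<le> e / 24"
          using D[of "(t, x)" "(t', x)"] t t' x by (simp add: dist_norm dist_Pair_Pair)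
      qed (use small_rescaled_driver[OF L] t t' in auto)
      then show "dist (profile (rescaled_driver \<kappa> t') 1) (profile (rescaled_driver \<kappa> t) 1) < e"
        using e by (simp add: dist_norm)
    qed
  qed
  then show ?thesis unfolding tip_def by (intro continuous_intros)
qed

text \<open>The earlier tip is swallowed at its own time, when the later one still survives.\<close>

lemma tip_inj:
  assumes L: "small_loewner_driver lam \<kappa> t0"
    and "s \<in> {0<..t0}" "t \<in> {0<..t0}" "tip \<kappa> s = tip \<kappa> t"
  shows "s = t"
proof (rule ccontr)
  assume "s \<noteq> t"
  then consider "s < t" | "t < s" by linarith
  then show False
  proof cases
    case 1
    then show False using tip_in_hull[OF L assms(2)] tip_notin_hull[OF L assms(3), of s] assms by simp
  next
    case 2
    then show False using tip_in_hull[OF L assms(3)] tip_notin_hull[OF L assms(2), of t] assms by simp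
  qed
qed

section \<open>Identification of the curve with the tip\<close>

lemma curve_in_hull:
  assumes "generates_curve T lam gam" "t \<in> {0<..T}" "gam t \<in> upper_half_plane"
  shows "gam t \<in> loewner_hull lam t"
proof -
  have "t \<in> {0..T}" using assms by auto
  then obtain x where x: "upper_half_plane - loewner_hull lam t =
             connected_component_set (upper_half_plane - gam ` {0<..t}) x"
    using assms(1) unfolding generates_curve_def by blast
  \<comment> \<open>Since \<open>t\<close> is positive, \<open>gam t\<close> is itself among the
    removed points, so no component of the complement contains it.\<close>
  have "gam t \<notin> connected_component_set (upper_half_plane - gam ` {0<..t}) x"
    using connected_component_subset[of "upper_half_plane - gam ` {0<..t}" x] assms(2) by auto
  then show ?thesis using x assms(3) by blast
qed

text \<open>A ball around the tip at time \<open>t\<close> contains tips at later times, which are not swallowed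
  by time \<open>t\<close>; hence the tip cannot be separated from them by the curve.\<close>

lemma tip_in_curve:
  assumes L: "small_loewner_driver lam \<kappa> t0"
    and gen: "generates_curve T lam gam" and T: "t0 \<le> T" and t: "t \<in> {0<..<t0}"
  shows "tip \<kappa> t \<in> gam ` {0..t}"
proof (rule ccontr)
  assume n: "tip \<kappa> t \<notin> gam ` {0..t}"
  have "continuous_on {0..t} gam"
  proof (rule continuous_on_subset)
    show "continuous_on {0..T} gam" using gen unfolding generates_curve_def by blast
  qed (use T t in auto)
  \<comment> \<open>Including time 0 makes the image compact, hence closed. The hull is described by
    removing only the positive times, a smaller set, so a ball avoiding the image avoids that set
    too.\<close>
  then have "compact (gam ` {0..t})" by (intro compact_continuous_image) auto
  then have "open (upper_half_plane - gam ` {0..t})"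
    by (auto simp: upper_half_plane_def open_halfspace_Im_gt compact_imp_closed)
  moreover have "tip \<kappa> t \<in> upper_half_plane - gam ` {0..t}"
    using n Im_tip_pos[OF L, of t] t by (auto simp: upper_half_plane_def)
  ultimately obtain e where e: "e > 0" and ball: "ball (tip \<kappa> t) e \<subseteq> upper_half_plane - gam ` {0..t}"
    unfolding open_contains_ball by blast
  have "t \<in> {0..t0}" using t by auto
  then obtain d where d: "d > 0" and
    D: "\<And>t'. t' \<in> {0..t0} \<Longrightarrow> dist t' t < d \<Longrightarrow> dist (tip \<kappa> t') (tip \<kappa> t) < e"
    using continuous_on_tip[OF L] e unfolding continuous_on_iff by metis
  \<comment> \<open>The cap keeps \<open>u\<close> in the range where tips are controlled; as
    \<open>t < t0\<close>, it still exceeds \<open>t\<close>.\<close>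
  define u where "u = min t0 (t + d / 2)"
  have u: "u \<in> {0<..t0}" "t < u" "dist u t < d" using d t by (auto simp: u_def dist_real_def min_def)
  have ub: "tip \<kappa> u \<in> ball (tip \<kappa> t) e" using D[of u] u by (auto simp: dist_commute)
  have "t \<in> {0..T}" using t T by auto
  then obtain x where x: "upper_half_plane - loewner_hull lam t =
             connected_component_set (upper_half_plane - gam ` {0<..t}) x"
    using gen unfolding generates_curve_def by blast
  have "tip \<kappa> u \<in> upper_half_plane - loewner_hull lam t"
    using tip_notin_hull[OF L, of u t] Im_tip_pos[OF L, of u] u t by (auto simp: upper_half_plane_def)
  then have 1: "connected_component (upper_half_plane - gam ` {0<..t}) x (tip \<kappa> u)" using x by auto
  have "connected_component (upper_half_plane - gam ` {0<..t}) (tip \<kappa> u) (tip \<kappa> t)"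
    unfolding connected_component_def
  proof (intro exI[of _ "ball (tip \<kappa> t) e"] conjI connected_ball ub)
    show "tip \<kappa> t \<in> ball (tip \<kappa> t) e" using e by simp
    have "gam ` {0<..t} \<subseteq> gam ` {0..t}" by (rule image_mono) auto
    then show "ball (tip \<kappa> t) e \<subseteq> upper_half_plane - gam ` {0<..t}" using ball by blast
  qed
  with 1 have "connected_component (upper_half_plane - gam ` {0<..t}) x (tip \<kappa> t)"
    by (rule connected_component_trans)
  then have "tip \<kappa> t \<notin> loewner_hull lam t" using x by auto
  then show False using tip_in_hull[OF L, of t] t by auto
qed

text \<open>The tip at \<open>t\<close> is some \<open>gam s\<close> with \<open>s \<le> t\<close>.
  If \<open>0 < s < t\<close>, that point would be swallowed by time \<open>s\<close>, unlike the
  tip. The case \<open>s = 0\<close> concerns at most one \<open>t\<close> by injectivity, and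
  shrinking the interval avoids it.\<close>

lemma curve_eq_tip:
  assumes L: "small_loewner_driver lam \<kappa> t0"
    and gen: "generates_curve T lam gam" and T: "t0 \<le> T"
  shows "\<exists>t1>0. t1 \<le> t0 \<and> (\<forall>t\<in>{0<..<t1}. gam t = tip \<kappa> t)"
proof -
  have eq: "gam t = tip \<kappa> t" if t: "t \<in> {0<..<t0}" and ne: "gam 0 \<noteq> tip \<kappa> t" for t
  proof -
    obtain s where s: "s \<in> {0..t}" "tip \<kappa> t = gam s" using tip_in_curve[OF L gen T t] by auto
    have s0: "s > 0" using s ne by (cases "s = 0") auto
    have "gam s \<in> loewner_hull lam s"
      using Im_tip_pos[OF L, of t] s t T s0 by (intro curve_in_hull[OF gen]) (auto simp: upper_half_plane_def)
    then have "\<not> s < t" using tip_notin_hull[OF L, of t s] s t by auto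
    then show ?thesis using s by auto
  qed
  show ?thesis
  proof (cases "\<exists>t\<in>{0<..<t0}. gam 0 = tip \<kappa> t")
    case True
    then obtain t1 where t1: "t1 \<in> {0<..<t0}" "gam 0 = tip \<kappa> t1" by blast
    have "gam t = tip \<kappa> t" if "t \<in> {0<..<t1}" for t
      using that t1 tip_inj[OF L, of t1 t] by (intro eq) auto
    then show ?thesis using t1 by (intro exI[of _ t1]) auto
  next
    case False
    then show ?thesis using eq small_loewner_driverD(1)[OF L] by (intro exI[of _ t0]) auto
  qed
qed

section \<open>Holomorphic dependence on the square root of time\<close>

text \<open>Joint continuity of the function and of its \<open>e\<close>-derivative is what the
  Leibniz rule requires, and the class is stable under products, moments and the square root used
  here.\<close>

definition joint_holo :: "complex set \<Rightarrow> (complex \<Rightarrow> real \<Rightarrow> complex) \<Rightarrow> bool" where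
  "joint_holo U F \<longleftrightarrow> continuous_on (U \<times> {0..1}) (\<lambda>(e, x). F e x) \<and>
     (\<exists>F'. continuous_on (U \<times> {0..1}) (\<lambda>(e, x). F' e x) \<and>
       (\<forall>e\<in>U. \<forall>x\<in>{0..1}. ((\<lambda>e. F e x) has_field_derivative F' e x) (at e within U)))"

lemma joint_holo_mult:
  assumes "joint_holo U F" "joint_holo U G"
  shows "joint_holo U (\<lambda>e x. F e x * G e x)"
proof -
  obtain F' G' where F': "continuous_on (U \<times> {0..1}) (\<lambda>(e, x). F' e x)"
      "\<And>e x. e \<in> U \<Longrightarrow> x \<in> {0..1} \<Longrightarrow> ((\<lambda>e. F e x) has_field_derivative F' e x) (at e within U)"
    and G': "continuous_on (U \<times> {0..1}) (\<lambda>(e, x). G' e x)"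
      "\<And>e x. e \<in> U \<Longrightarrow> x \<in> {0..1} \<Longrightarrow> ((\<lambda>e. G e x) has_field_derivative G' e x) (at e within U)"
    using assms unfolding joint_holo_def by blast
  have c: "continuous_on (U \<times> {0..1}) (\<lambda>(e, x). F e x)" "continuous_on (U \<times> {0..1}) (\<lambda>(e, x). G e x)"
    using assms unfolding joint_holo_def by blast+
  show ?thesis
    unfolding joint_holo_def
  proof (intro conjI exI[of _ "\<lambda>e x. F' e x * G e x + G' e x * F e x"] ballI)
    show "continuous_on (U \<times> {0..1}) (\<lambda>(e, x). F e x * G e x)"
      "continuous_on (U \<times> {0..1}) (\<lambda>(e, x). F' e x * G e x + G' e x * F e x)"
      using c F'(1) G'(1) unfolding case_prod_unfold by - (intro continuous_on_add continuous_on_mult; assumption)+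
    fix e and x :: real assume "e \<in> U" "x \<in> {0..1}"
    from DERIV_mult'[OF F'(2)[OF this] G'(2)[OF this]]
    show "((\<lambda>e. F e x * G e x) has_field_derivative F' e x * G e x + G' e x * F e x) (at e within U)"
      by (simp add: algebra_simps)
  qed
qed

lemma joint_holo_moment:
  assumes U: "convex U" and F: "joint_holo U F"
  shows "joint_holo U (\<lambda>e. moment (F e))"
proof -
  obtain F' where F': "continuous_on (U \<times> {0..1}) (\<lambda>(e, x). F' e x)"
      "\<And>e x. e \<in> U \<Longrightarrow> x \<in> {0..1} \<Longrightarrow> ((\<lambda>e. F e x) has_field_derivative F' e x) (at e within U)"
    and c: "continuous_on (U \<times> {0..1}) (\<lambda>(e, x). F e x)"
    using F unfolding joint_holo_def by blast
  show ?thesis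
    unfolding joint_holo_def
  proof (intro conjI exI[of _ "\<lambda>e. moment (F' e)"] ballI)
    show "continuous_on (U \<times> {0..1}) (\<lambda>(e, \<sigma>). moment (F e) \<sigma>)"
      by (rule continuous_on_moment_param[OF c])
    show "continuous_on (U \<times> {0..1}) (\<lambda>(e, \<sigma>). moment (F' e) \<sigma>)"
      by (rule continuous_on_moment_param[OF F'(1)])
    fix e and \<sigma> :: real assume e: "e \<in> U" and \<sigma>: "\<sigma> \<in> {0..1}"
    have "((\<lambda>e. integral (cbox 0 1) (\<lambda>\<theta>. of_real (\<theta>\<^sup>2) * F e (\<sigma> * \<theta>))) has_field_derivative
        integral (cbox 0 1) (\<lambda>\<theta>. of_real (\<theta>\<^sup>2) * F' e (\<sigma> * \<theta>))) (at e within U)"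
    proof (rule leibniz_rule_field_derivative[OF _ _ _ e U])
      fix w and \<theta> :: real assume w: "w \<in> U" and \<theta>: "\<theta> \<in> cbox 0 1"
      then have "\<sigma> * \<theta> \<in> {0..1}" using mult_mem_unit_interval[OF \<sigma>] by auto
      then show "((\<lambda>e. of_real (\<theta>\<^sup>2) * F e (\<sigma> * \<theta>)) has_field_derivative of_real (\<theta>\<^sup>2) * F' w (\<sigma> * \<theta>)) (at w within U)"
        by (intro DERIV_cmult F'(2) w)
    next
      fix w assume w: "w \<in> U"
      have "continuous_on {0..1} (F w)"
        using continuous_on_compose2[OF c, of "{0..1}" "\<lambda>x. (w, x)"] w
        by (force intro!: continuous_intros)
      from integrable_moment_integrand[OF this \<sigma>]
      show "(\<lambda>\<theta>. of_real (\<theta>\<^sup>2) * F w (\<sigma> * \<theta>)) integrable_on cbox 0 1" by (simp add: cbox_interval)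
    next
      have "continuous_on (U \<times> cbox 0 1) (\<lambda>p. (case (fst p, \<sigma> * snd p) of (e, x) \<Rightarrow> F' e x))"
      proof (rule continuous_on_compose2[OF F'(1), of _ "\<lambda>p. (fst p, \<sigma> * snd p)"])
        show "continuous_on (U \<times> cbox 0 1) (\<lambda>p. (fst p, \<sigma> * snd p))" by (intro continuous_intros)
        show "(\<lambda>p. (fst p, \<sigma> * snd p)) ` (U \<times> cbox 0 1) \<subseteq> U \<times> {0..1}"
          unfolding cbox_interval
          by (auto simp del: atLeastAtMost_iff intro!: mult_mem_unit_interval[OF \<sigma>])
      qed
      then have "continuous_on (U \<times> cbox 0 1) (\<lambda>p. F' (fst p) (\<sigma> * snd p))" by simp
      moreover have "continuous_on (U \<times> cbox 0 1) (\<lambda>p. complex_of_real ((snd p)\<^sup>2))"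
        by (intro continuous_intros)
      ultimately show "continuous_on (U \<times> cbox 0 1) (\<lambda>(e, \<theta>). of_real (\<theta>\<^sup>2) * F' e (\<sigma> * \<theta>))"
        unfolding case_prod_unfold by (rule continuous_on_mult[rotated])
    qed
    then show "((\<lambda>e. moment (F e) \<sigma>) has_field_derivative moment (F' e) \<sigma>) (at e within U)"
      unfolding moment_def by (intro DERIV_cmult) (simp add: cbox_interval)
  qed
qed

lemma joint_holo_csqrt:
  assumes F: "joint_holo U F" and small: "\<And>e x. e \<in> U \<Longrightarrow> x \<in> {0..1} \<Longrightarrow> norm (F e x) \<le> 1/8"
  shows "joint_holo U (\<lambda>e x. 2 * \<i> * csqrt (1 - F e x))"
proof -
  obtain F' where F': "continuous_on (U \<times> {0..1}) (\<lambda>(e, x). F' e x)"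
      "\<And>e x. e \<in> U \<Longrightarrow> x \<in> {0..1} \<Longrightarrow> ((\<lambda>e. F e x) has_field_derivative F' e x) (at e within U)"
    and c: "continuous_on (U \<times> {0..1}) (\<lambda>(e, x). F e x)"
    using F unfolding joint_holo_def by blast
  have ne: "csqrt (1 - F e x) \<noteq> 0" if "e \<in> U" "x \<in> {0..1}" for e x
    using Re_csqrt_ge_half[OF small[OF that]] by (auto simp del: csqrt.simps csqrt_eq_0)
  have cs: "continuous_on (U \<times> {0..1}) (\<lambda>p. csqrt (1 - F (fst p) (snd p)))"
    by (rule continuous_on_compose2[OF continuous_on_csqrt])
       (use c not_nonpos_near_one[OF small] in \<open>auto simp: case_prod_unfold intro!: continuous_intros\<close>)
  show ?thesis
    unfolding joint_holo_def
  proof (intro conjI exI[of _ "\<lambda>e x. 2 * \<i> * (- F' e x * inverse (2 * csqrt (1 - F e x)))"] ballI)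
    show "continuous_on (U \<times> {0..1}) (\<lambda>(e, x). 2 * \<i> * csqrt (1 - F e x))"
      unfolding case_prod_unfold by (intro continuous_intros cs)
    show "continuous_on (U \<times> {0..1}) (\<lambda>(e, x). 2 * \<i> * (- F' e x * inverse (2 * csqrt (1 - F e x))))"
      using F'(1) ne unfolding case_prod_unfold by (intro continuous_intros cs) auto
    fix e and x :: real assume e: "e \<in> U" and x: "x \<in> {0..1}"
    have "((\<lambda>e. 1 - F e x) has_field_derivative - F' e x) (at e within U)"
      using F'(2)[OF e x] by (auto intro!: derivative_eq_intros)
    from DERIV_chain2[OF has_field_derivative_csqrt[OF not_nonpos_near_one[OF small[OF e x]]] this]
    show "((\<lambda>e. 2 * \<i> * csqrt (1 - F e x)) has_field_derivative
        2 * \<i> * (- F' e x * inverse (2 * csqrt (1 - F e x)))) (at e within U)"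
      by (intro DERIV_cmult) (simp add: mult.commute)
  qed
qed

lemma joint_holo_iter:
  assumes U: "convex U" and Q: "joint_holo U Q" and small: "\<And>e. e \<in> U \<Longrightarrow> small_driver (Q e)"
  shows "joint_holo U (\<lambda>e. loewner_iter (Q e) k)"
proof (induction k)
  case 0
  show ?case unfolding joint_holo_def loewner_iter_def
    by (auto simp: case_prod_unfold intro!: exI[of _ "\<lambda>_ _. 0"])
next
  case (Suc k)
  have "joint_holo U (\<lambda>e \<sigma>. 2 * \<i> * csqrt (1 - moment (\<lambda>x. loewner_iter (Q e) k x * Q e x) \<sigma>))"
    by (intro joint_holo_csqrt joint_holo_moment joint_holo_mult U Q Suc.IH
        near_vertical_product(3) near_vertical_iter small)
  then show ?case by (simp add: loewner_iter_Suc loewner_step_def)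
qed

text \<open>The iterates are holomorphic in \<open>e\<close> and converge at a rate independent of
  \<open>e\<close>; locally uniform limits of holomorphic functions are holomorphic.\<close>

lemma holomorphic_on_profile:
  assumes U: "open U" "convex U" and Q: "joint_holo U Q" and small: "\<And>e. e \<in> U \<Longrightarrow> small_driver (Q e)"
    and \<sigma>: "\<sigma> \<in> {0..1}"
  shows "(\<lambda>e. profile (Q e) \<sigma>) holomorphic_on U"
proof (rule holomorphic_uniform_sequence[OF U(1)])
  fix k
  obtain F' where "\<And>e x. e \<in> U \<Longrightarrow> x \<in> {0..1} \<Longrightarrow>
      ((\<lambda>e. loewner_iter (Q e) k x) has_field_derivative F' e x) (at e within U)"
    using joint_holo_iter[OF U(2) Q small, of k] unfolding joint_holo_def by blast
  then show "(\<lambda>e. loewner_iter (Q e) k \<sigma>) holomorphic_on U"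
    unfolding holomorphic_on_def field_differentiable_def using \<sigma> by blast
next
  fix w assume "w \<in> U"
  then obtain d where d: "d > 0" "cball w d \<subseteq> U" using U(1) open_contains_cball by blast
  have "uniform_limit (cball w d) (\<lambda>k e. loewner_iter (Q e) k \<sigma>) (\<lambda>e. profile (Q e) \<sigma>) sequentially"
  proof (rule uniform_limitI)
    fix r :: real assume "r > 0"
    have "(\<lambda>k. 2 * (1/2::real) ^ k) \<longlonglongrightarrow> 2 * 0" by (intro tendsto_intros) auto
    then have "\<forall>\<^sub>F k in sequentially. 2 * (1/2::real) ^ k < r"
      using \<open>r > 0\<close> by (intro order_tendstoD) auto
    then show "\<forall>\<^sub>F k in sequentially. \<forall>e\<in>cball w d. dist (loewner_iter (Q e) k \<sigma>) (profile (Q e) \<sigma>) < r"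
    proof (rule eventually_mono, intro ballI)
      fix k e assume "2 * (1/2::real) ^ k < r" "e \<in> cball w d"
      then have "e \<in> U" "2 * (1/2::real) ^ k < r" using d by auto
      then show "dist (loewner_iter (Q e) k \<sigma>) (profile (Q e) \<sigma>) < r"
        using loewner_iter_tendsto(2)[OF small \<sigma>, of e k] by (simp add: dist_commute dist_norm)
    qed
  qed
  then show "\<exists>d>0. cball w d \<subseteq> U \<and>
      uniform_limit (cball w d) (\<lambda>k e. loewner_iter (Q e) k \<sigma>) (\<lambda>e. profile (Q e) \<sigma>) sequentially"
    using d by blast
qed

text \<open>If \<open>Z\<close> and \<open>Q\<close> both become negative conjugates,
  \<open>Z * Q\<close> is merely conjugated. Conjugation passes through moment and root, and the
  factor \<open>2 * \<i>\<close> supplies the sign.\<close>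

lemma profile_reflect:
  assumes Q: "small_driver Q" and \<sigma>: "\<sigma> \<in> {0..1}"
  shows "profile (\<lambda>x. - cnj (Q x)) \<sigma> = - cnj (profile Q \<sigma>)"
proof -
  have Q': "small_driver (\<lambda>x. - cnj (Q x))"
    using Q by (auto simp: small_driver_def intro!: continuous_intros)
  have it: "loewner_iter (\<lambda>x. - cnj (Q x)) k \<sigma> = - cnj (loewner_iter Q k \<sigma>)" if "\<sigma> \<in> {0..1}" for k \<sigma>
    using that
  proof (induction k arbitrary: \<sigma>)
    case (Suc k)
    let ?m = "moment (\<lambda>x. loewner_iter Q k x * Q x) \<sigma>"
    have "moment (\<lambda>x. loewner_iter (\<lambda>x. - cnj (Q x)) k x * - cnj (Q x)) \<sigma> =
        of_real \<sigma> * integral {0..1} (\<lambda>\<theta>. cnj (of_real (\<theta>\<^sup>2) * (loewner_iter Q k (\<sigma> * \<theta>) * Q (\<sigma> * \<theta>))))"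
      unfolding moment_def
      by (rule arg_cong[where f = "(*) _"], rule integral_cong)
         (simp add: Suc.IH[OF mult_mem_unit_interval[OF Suc.prems]] del: mult_minus_right)
    also have "\<dots> = cnj ?m" unfolding moment_def complex_cnj_mult[of "of_real \<sigma>"] integral_cnj by simp
    finally have m: "moment (\<lambda>x. loewner_iter (\<lambda>x. - cnj (Q x)) k x * - cnj (Q x)) \<sigma> = cnj ?m" .
    have "norm ?m \<le> 1/8" by (rule near_vertical_product(3)[OF Q near_vertical_iter[OF Q] Suc.prems])
    \<comment> \<open>The conjugate of the root has the same positive real part, hence is the
      principal root of the conjugate.\<close>
    then have "csqrt (1 - cnj ?m) = cnj (csqrt (1 - ?m))"
      using Re_csqrt_ge_half[of ?m]
      by (intro csqrt_unique) (auto simp flip: complex_cnj_power simp del: csqrt.simps)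
    then show ?case unfolding loewner_iter_Suc loewner_step_def m by simp
  qed (simp add: loewner_iter_def)
  have "(\<lambda>k. - cnj (loewner_iter Q k \<sigma>)) \<longlonglongrightarrow> - cnj (profile Q \<sigma>)"
    by (intro tendsto_intros loewner_iter_tendsto(1) Q \<sigma>)
  then have "(\<lambda>k. loewner_iter (\<lambda>x. - cnj (Q x)) k \<sigma>) \<longlonglongrightarrow> - cnj (profile Q \<sigma>)"
    using it[OF \<sigma>] by simp
  with loewner_iter_tendsto(1)[OF Q' \<sigma>] show ?thesis by (rule LIMSEQ_unique)
qed

lemma profile_zero:
  assumes "\<sigma> \<in> {0..1}"
  shows "profile (\<lambda>_. 0) \<sigma> = 2 * \<i>"
proof -
  have "loewner_step (\<lambda>_. 0) (profile (\<lambda>_. 0)) \<sigma> = profile (\<lambda>_. 0) \<sigma>"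
    by (rule profile_fixed_point) (use assms in \<open>auto simp: small_driver_def\<close>)
  then show ?thesis by (simp add: loewner_step_def moment_def)
qed

section \<open>Taylor remainders and uniqueness of asymptotic coefficients\<close>

lemma holomorphic_taylor_bound:
  assumes f: "f holomorphic_on ball 0 r" and r: "r > 0"
  shows "\<exists>C\<ge>0. \<exists>\<delta>>0. \<forall>w. norm w \<le> \<delta> \<longrightarrow>
    norm (f w - (\<Sum>j<N. (deriv ^^ j) f 0 / fact j * w ^ j)) \<le> C * norm w ^ N"
proof -
  define c where "c j = (deriv ^^ j) f 0 / fact j" for j
  have sums: "(\<lambda>j. c j * w ^ j) sums f w" if "norm w < r" for w
    using holomorphic_power_series[OF f, of w] that by (simp add: c_def)
  \<comment> \<open>Convergence at \<open>r / 2\<close> bounds the terms there, so the coefficients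
    grow at most like \<open>(2 / r) ^ j\<close>.\<close>
  have "summable (\<lambda>j. c j * of_real (r / 2) ^ j)"
    using sums[of "of_real (r / 2)"] r by (auto simp: sums_iff)
  then have "Bseq (\<lambda>j. c j * of_real (r / 2) ^ j)"
    by (rule summable_LIMSEQ_zero[THEN convergentI, THEN convergent_imp_Bseq])
  then obtain B where B: "B > 0" "\<And>j. norm (c j * of_real (r / 2) ^ j) \<le> B" by (auto simp: Bseq_def)
  have cB: "norm (c j) \<le> B * (2 / r) ^ j" for j
    using B(2)[of j] r by (simp add: norm_mult norm_divide norm_power power_divide field_simps)
  \<comment> \<open>For \<open>norm w \<le> r / 4\<close> the tail is dominated by a geometric
    series of ratio 1/2, which sums to twice its first term.\<close>
  have bound: "norm (f w - (\<Sum>j<N. (deriv ^^ j) f 0 / fact j * w ^ j)) \<le> 2 * B * (2 / r) ^ N * norm w ^ N"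
    if w: "norm w \<le> r / 4" for w
  proof -
    have "(\<lambda>j. c (j + N) * w ^ (j + N)) sums (f w - (\<Sum>j<N. c j * w ^ j))"
      using sums_split_initial_segment[OF sums[of w], of N] w r by simp
    moreover have le: "norm (c (j + N) * w ^ (j + N)) \<le> B * (2 / r) ^ N * norm w ^ N * (1/2) ^ j" for j
    proof -
      have "norm (c (j + N) * w ^ (j + N)) \<le> B * (2 / r) ^ (j + N) * norm w ^ (j + N)"
        unfolding norm_mult norm_power by (intro mult_right_mono cB) auto
      also have "\<dots> = B * (2 / r) ^ N * norm w ^ N * (2 / r * norm w) ^ j"
        unfolding power_add power_mult_distrib by (simp only: mult_ac)
      also have "\<dots> \<le> B * (2 / r) ^ N * norm w ^ N * (1/2) ^ j"
        using w r B(1) by (intro mult_left_mono power_mono) (auto simp: field_simps)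
      finally show ?thesis .
    qed
    have g: "(\<lambda>j. B * (2 / r) ^ N * norm w ^ N * (1/2) ^ j) sums (B * (2 / r) ^ N * norm w ^ N * 2)"
      using sums_mult[OF geometric_sums[of "1/2::real"], of "B * (2 / r) ^ N * norm w ^ N"] by simp
    ultimately have "norm (f w - (\<Sum>j<N. c j * w ^ j)) \<le> B * (2 / r) ^ N * norm w ^ N * 2"
      using norm_suminf_le[OF le sums_summable[OF g]] by (simp add: sums_iff)
    then show "norm (f w - (\<Sum>j<N. (deriv ^^ j) f 0 / fact j * w ^ j)) \<le> 2 * B * (2 / r) ^ N * norm w ^ N"
      by (simp add: c_def mult_ac)
  qed
  have "2 * B * (2 / r) ^ N \<ge> 0" "r / 4 > 0" using r B by auto
  with bound show ?thesis by blast
qed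

text \<open>Letting \<open>x\<close> tend to 0 from the right kills the constant coefficient;
  dividing by \<open>x\<close> then lowers \<open>N\<close> by one.\<close>

lemma asymptotic_coeffs_zero:
  fixes c :: "nat \<Rightarrow> complex"
  assumes "\<delta> > 0" and "\<And>x. 0 < x \<Longrightarrow> x < \<delta> \<Longrightarrow> norm (\<Sum>j<N. c j * of_real x ^ j) \<le> C * x ^ N"
    and "j < N"
  shows "c j = 0"
  using assms(2,3)
proof (induction N arbitrary: c j)
  case (Suc N)
  have ev: "\<forall>\<^sub>F x in at_right 0. x \<in> {0<..<\<delta>}"
    using assms(1) by (intro eventually_at_rightI[of 0 \<delta>]) auto
  have split: "(\<Sum>j<Suc N. c j * of_real x ^ j) = c 0 + of_real x * (\<Sum>j<N. c (Suc j) * of_real x ^ j)" for x :: real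
    unfolding sum.lessThan_Suc_shift by (simp add: sum_distrib_left mult_ac)
  have "((\<lambda>x. \<Sum>j<Suc N. c j * of_real x ^ j) \<longlongrightarrow> c 0 + of_real 0 * (\<Sum>j<N. c (Suc j) * of_real 0 ^ j)) (at_right 0)"
    unfolding split by (intro tendsto_intros)
  moreover have "((\<lambda>x. \<Sum>j<Suc N. c j * of_real x ^ j) \<longlongrightarrow> 0) (at_right 0)"
  proof (rule Lim_null_comparison)
    show "\<forall>\<^sub>F x in at_right 0. norm (\<Sum>j<Suc N. c j * of_real x ^ j) \<le> C * x ^ Suc N"
      using ev by eventually_elim (intro Suc.prems; auto)
    have "((\<lambda>x. C * x ^ Suc N) \<longlongrightarrow> C * 0 ^ Suc N) (at_right (0::real))" by (intro tendsto_intros)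
    then show "((\<lambda>x. C * x ^ Suc N) \<longlongrightarrow> 0) (at_right (0::real))" by simp
  qed
  ultimately have c0: "c 0 = 0" using tendsto_unique[OF trivial_limit_at_right_real] by fastforce
  have "c (Suc i) = 0" if "i < N" for i
  proof (rule Suc.IH[of "\<lambda>j. c (Suc j)", OF _ that])
    fix x :: real assume x: "0 < x" "x < \<delta>"
    have "x * norm (\<Sum>j<N. c (Suc j) * of_real x ^ j) \<le> x * (C * x ^ N)"
      using Suc.prems(1)[OF x] x unfolding split c0 by (simp add: norm_mult mult_ac)
    then show "norm (\<Sum>j<N. c (Suc j) * of_real x ^ j) \<le> C * x ^ N" using x by simp
  qed
  then show ?case using c0 Suc.prems(2) by (cases j) auto
qed simp

section \<open>Polynomial drivers\<close>

text \<open>With \<open>d k\<close> for the \<open>k\<close>-th derivative of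
  \<open>\<lambda>\<close> at 0 and \<open>e\<close> for \<open>sqrt t\<close>, this is
  \<open>sqrt t\<close> times the Taylor polynomial of \<open>\<lambda>'\<close> at
  \<open>t * (1 - \<sigma>^2)\<close>. As \<open>t = e^2\<close>, only odd powers of
  \<open>e\<close> occur.\<close>

definition jet_driver :: "nat \<Rightarrow> (nat \<Rightarrow> real) \<Rightarrow> complex \<Rightarrow> real \<Rightarrow> complex" where
  "jet_driver n d e \<sigma> = (\<Sum>k=1..n. of_real (d k / fact (k - 1) * (1 - \<sigma>\<^sup>2) ^ (k - 1)) * e ^ (2 * k - 1))"

text \<open>For \<open>norm e \<le> 1\<close> the driver is at most \<open>norm e\<close> times the
  sum of the \<open>\<bar>d k\<bar>\<close>. The added 1 ensures \<open>norm e \<le> 1\<close> and a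
  nonzero denominator; 24 comes from \<open>small_driver\<close>.\<close>

definition jet_radius :: "nat \<Rightarrow> (nat \<Rightarrow> real) \<Rightarrow> real" where
  "jet_radius n d = 1 / (24 * (1 + (\<Sum>k=1..n. \<bar>d k\<bar>)))"

definition jet_map :: "nat \<Rightarrow> (nat \<Rightarrow> real) \<Rightarrow> complex \<Rightarrow> complex" where
  "jet_map n d e = profile (jet_driver n d e) 1"

text \<open>Because \<open>tip\<close> carries an extra factor \<open>sqrt t\<close>, coefficient
  \<open>j\<close> belongs to the power \<open>(j + 1) / 2\<close> of \<open>t\<close>.\<close>

definition jet_coeff :: "nat \<Rightarrow> (nat \<Rightarrow> real) \<Rightarrow> nat \<Rightarrow> complex" where
  "jet_coeff n d j = (deriv ^^ j) (jet_map n d) 0 / fact j"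

lemma jet_radius_pos: "jet_radius n d > 0"
  by (auto simp: jet_radius_def intro!: add_pos_nonneg sum_nonneg)

lemma jet_radius_le_1: "jet_radius n d \<le> 1"
proof -
  define S where "S = (\<Sum>k=1..n. \<bar>d k\<bar>)"
  have "0 \<le> S" unfolding S_def by (rule sum_nonneg) auto
  then show ?thesis unfolding jet_radius_def S_def[symmetric] by simp
qed

text \<open>Terms with \<open>k \<le> K\<close> cancel, and the others carry powers
  \<open>2 * k - 1\<close> of at least \<open>2 * K + 1\<close>. With \<open>K = 0\<close> and
  \<open>d' = 0\<close> this is also the size bound for one driver.\<close>

lemma jet_driver_diff_le:
  assumes \<sigma>: "\<sigma> \<in> {0..1}" and e: "norm e \<le> 1" and eq: "\<And>k. k \<in> {1..K} \<Longrightarrow> d k = d' k"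
  shows "norm (jet_driver n d e \<sigma> - jet_driver n d' e \<sigma>) \<le> (\<Sum>k=1..n. \<bar>d k - d' k\<bar>) * norm e ^ (2 * K + 1)"
proof -
  have eq_sum: "jet_driver n d e \<sigma> - jet_driver n d' e \<sigma> =
      (\<Sum>k=1..n. of_real ((d k - d' k) / fact (k - 1) * (1 - \<sigma>\<^sup>2) ^ (k - 1)) * e ^ (2 * k - 1))"
    unfolding jet_driver_def sum_subtractf[symmetric]
    by (intro sum.cong refl) (simp add: diff_divide_distrib algebra_simps)
  show ?thesis
    unfolding eq_sum sum_distrib_right
  proof (rule sum_norm_le)
    fix k assume k: "k \<in> {1..n}"
    show "norm (of_real ((d k - d' k) / fact (k - 1) * (1 - \<sigma>\<^sup>2) ^ (k - 1)) * e ^ (2 * k - 1))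
        \<le> \<bar>d k - d' k\<bar> * norm e ^ (2 * K + 1)"
    proof (cases "k \<le> K")
      case True then show ?thesis using eq[of k] k by simp
    next
      case False
      have "\<bar>d k - d' k\<bar> / fact (k - 1) * \<bar>1 - \<sigma>\<^sup>2\<bar> ^ (k - 1) \<le> \<bar>d k - d' k\<bar> * 1"
      proof (intro mult_mono power_le_one)
        show "\<bar>d k - d' k\<bar> / fact (k - 1) \<le> \<bar>d k - d' k\<bar>"
          by (simp add: divide_le_eq_1 mult_le_cancel_left1 divide_le_eq)
        have "\<sigma>\<^sup>2 \<le> 1" using \<sigma> by (auto intro: power_le_one)
        then show "\<bar>1 - \<sigma>\<^sup>2\<bar> \<le> 1" by simp
      qed auto
      moreover have "norm e ^ (2 * k - 1) \<le> norm e ^ (2 * K + 1)"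
        using False e by (intro power_decreasing) auto
      ultimately have "\<bar>d k - d' k\<bar> / fact (k - 1) * \<bar>1 - \<sigma>\<^sup>2\<bar> ^ (k - 1) * norm e ^ (2 * k - 1)
          \<le> \<bar>d k - d' k\<bar> * 1 * norm e ^ (2 * K + 1)"
        by (rule mult_mono) auto
      then show ?thesis
        by (simp only: norm_mult norm_of_real norm_power abs_mult abs_divide power_abs abs_of_pos[OF fact_gt_zero] mult_1_right)
    qed
  qed
qed

lemma small_jet_driver:
  assumes e: "norm e \<le> jet_radius n d"
  shows "small_driver (jet_driver n d e)"
  unfolding small_driver_def
proof safe
  show "continuous_on {0..1} (jet_driver n d e)"
    unfolding jet_driver_def by (intro continuous_intros)
  fix \<sigma> :: real assume "\<sigma> \<in> {0..1}"
  define S where "S = (\<Sum>k=1..n. \<bar>d k\<bar>)"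
  have S: "0 \<le> S" unfolding S_def by (rule sum_nonneg) auto
  have "norm (jet_driver n d e \<sigma> - jet_driver n (\<lambda>_. 0) e \<sigma>) \<le> (\<Sum>k=1..n. \<bar>d k - 0\<bar>) * norm e ^ (2 * 0 + 1)"
    by (rule jet_driver_diff_le) (use \<open>\<sigma> \<in> {0..1}\<close> e jet_radius_le_1[of n d] in auto)
  then have "norm (jet_driver n d e \<sigma>) \<le> S * norm e" by (simp add: jet_driver_def S_def)
  also have "\<dots> \<le> (1 + S) * jet_radius n d" using S e by (intro mult_mono) auto
  also have "\<dots> = 1/24" using S unfolding jet_radius_def S_def[symmetric] by simp
  finally show "norm (jet_driver n d e \<sigma>) \<le> 1/24" .
qed

lemma joint_holo_jet_driver: "joint_holo U (jet_driver n d)"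
  unfolding joint_holo_def
proof (intro conjI exI[of _ "\<lambda>e \<sigma>. \<Sum>k=1..n. of_real (d k / fact (k - 1) * (1 - \<sigma>\<^sup>2) ^ (k - 1)) *
      (of_nat (2 * k - 1) * e ^ (2 * k - 1 - 1))"] ballI)
  show "continuous_on (U \<times> {0..1}) (\<lambda>(e, \<sigma>). jet_driver n d e \<sigma>)"
    unfolding case_prod_unfold jet_driver_def by (intro continuous_intros)
  show "continuous_on (U \<times> {0..1}) (\<lambda>(e, \<sigma>). \<Sum>k=1..n. of_real (d k / fact (k - 1) * (1 - \<sigma>\<^sup>2) ^ (k - 1)) *
      (of_nat (2 * k - 1) * e ^ (2 * k - 1 - 1)))"
    unfolding case_prod_unfold by (intro continuous_intros)
  fix e and \<sigma> :: real
  show "((\<lambda>e. jet_driver n d e \<sigma>) has_field_derivative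
      (\<Sum>k=1..n. of_real (d k / fact (k - 1) * (1 - \<sigma>\<^sup>2) ^ (k - 1)) * (of_nat (2 * k - 1) * e ^ (2 * k - 1 - 1))))
      (at e within U)"
    unfolding jet_driver_def by (intro DERIV_sum DERIV_cmult) (auto intro!: derivative_eq_intros)
qed

lemma holomorphic_jet_map: "jet_map n d holomorphic_on ball 0 (jet_radius n d)"
  unfolding jet_map_def[abs_def]
  by (rule holomorphic_on_profile) (auto intro!: joint_holo_jet_driver small_jet_driver)

lemma jet_map_expansion:
  "\<exists>C\<ge>0. \<exists>\<delta>>0. \<forall>w. norm w \<le> \<delta> \<longrightarrow>
    norm (jet_map n d w - (\<Sum>j<N. jet_coeff n d j * w ^ j)) \<le> C * norm w ^ N"
  unfolding jet_coeff_def by (rule holomorphic_taylor_bound[OF holomorphic_jet_map[of n d] jet_radius_pos, of N])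

lemma jet_coeff_0: "jet_coeff n d 0 = 2 * \<i>"
proof -
  have "jet_driver n d 0 = (\<lambda>_. 0)" by (rule ext) (auto simp: jet_driver_def intro!: sum.neutral)
  then show ?thesis by (simp add: jet_coeff_def jet_map_def profile_zero)
qed

text \<open>The driver is odd in \<open>e\<close> with real coefficients, so at real arguments
  negating \<open>e\<close> is the reflection \<open>Q \<mapsto> - cnj Q\<close>.\<close>

lemma jet_map_reflect:
  assumes x: "\<bar>x\<bar> \<le> jet_radius n d"
  shows "jet_map n d (- of_real x) = - cnj (jet_map n d (of_real x))"
proof -
  have "jet_driver n d (- of_real x) \<sigma> = - cnj (jet_driver n d (of_real x) \<sigma>)" for \<sigma>
    unfolding jet_driver_def cnj_sum sum_negf[symmetric]
  proof (rule sum.cong[OF refl])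
    fix k assume "k \<in> {1..n}"
    then have "odd (2 * k - 1)" by auto
    then have "(- complex_of_real x) ^ (2 * k - 1) = - (of_real x ^ (2 * k - 1))" by (rule power_minus_odd)
    then show "of_real (d k / fact (k - 1) * (1 - \<sigma>\<^sup>2) ^ (k - 1)) * (- complex_of_real x) ^ (2 * k - 1) =
        - cnj (of_real (d k / fact (k - 1) * (1 - \<sigma>\<^sup>2) ^ (k - 1)) * of_real x ^ (2 * k - 1))" by simp
  qed
  then have "jet_driver n d (- of_real x) = (\<lambda>\<sigma>. - cnj (jet_driver n d (of_real x) \<sigma>))" by auto
  then show ?thesis using profile_reflect[OF small_jet_driver, of "of_real x" n d 1] x
    by (simp add: jet_map_def)
qed

text \<open>Comparing the expansions at \<open>x\<close> and \<open>- x\<close> through the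
  reflection shows that coefficients are imaginary for even \<open>j\<close> and real for odd
  \<open>j\<close>.\<close>

lemma jet_coeff_parity: "(-1) ^ j * jet_coeff n d j + cnj (jet_coeff n d j) = 0"
proof -
  obtain C \<delta> where C: "C \<ge> 0" "\<delta> > 0"
    "\<And>w. norm w \<le> \<delta> \<Longrightarrow> norm (jet_map n d w - (\<Sum>i<Suc j. jet_coeff n d i * w ^ i)) \<le> C * norm w ^ Suc j"
    using jet_map_expansion[where n = n and d = d and N = "Suc j"] by blast
  show ?thesis
  proof (rule asymptotic_coeffs_zero[where N = "Suc j" and \<delta> = "min \<delta> (jet_radius n d)" and C = "2 * C"])
    fix x :: real assume x: "0 < x" "x < min \<delta> (jet_radius n d)"
    define P where "P w = (\<Sum>i<Suc j. jet_coeff n d i * w ^ i)" for w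
    have "(\<Sum>i<Suc j. ((-1) ^ i * jet_coeff n d i + cnj (jet_coeff n d i)) * of_real x ^ i)
        = P (- of_real x) + cnj (P (of_real x))"
      unfolding P_def cnj_sum sum.distrib[symmetric]
      by (rule sum.cong[OF refl]) (simp add: power_minus[of "complex_of_real x"] algebra_simps)
    also have "\<dots> = - (jet_map n d (- of_real x) - P (- of_real x)) - cnj (jet_map n d (of_real x) - P (of_real x))"
      using jet_map_reflect[of x n d] x by simp
    also have "norm \<dots> \<le> norm (jet_map n d (- of_real x) - P (- of_real x)) + norm (jet_map n d (of_real x) - P (of_real x))"
      using norm_triangle_ineq4[of "- (jet_map n d (- of_real x) - P (- of_real x))" "cnj (jet_map n d (of_real x) - P (of_real x))"]
      by (simp only: norm_minus_cancel complex_mod_cnj)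
    also have "\<dots> \<le> C * x ^ Suc j + C * x ^ Suc j"
    proof (rule add_mono)
      have nx: "norm (complex_of_real x) = x" "norm (- complex_of_real x) = x" "x \<le> \<delta>" using x by auto
      show "norm (jet_map n d (- of_real x) - P (- of_real x)) \<le> C * x ^ Suc j"
        using C(3)[of "- of_real x"] unfolding nx(2) P_def by (simp only: nx(3))
      show "norm (jet_map n d (of_real x) - P (of_real x)) \<le> C * x ^ Suc j"
        using C(3)[of "of_real x"] unfolding nx(1) P_def by (simp only: nx(3))
    qed
    finally show "norm (\<Sum>i<Suc j. ((-1) ^ i * jet_coeff n d i + cnj (jet_coeff n d i)) * of_real x ^ i) \<le> 2 * C * x ^ Suc j"
      by simp
  qed (use C jet_radius_pos in auto)
qed

text \<open>The two drivers, and by Lipschitz dependence the two jet maps, differ by at most a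
  multiple of \<open>x ^ (2 * K + 1)\<close>, so all lower coefficients coincide.\<close>

lemma jet_coeff_cong:
  assumes eq: "\<And>k. k \<in> {1..K} \<Longrightarrow> d k = d' k" and j: "j < 2 * K + 1"
  shows "jet_coeff n d j = jet_coeff n d' j"
proof -
  let ?N = "2 * K + 1"
  obtain C \<delta> where C: "C \<ge> 0" "\<delta> > 0"
    "\<And>w. norm w \<le> \<delta> \<Longrightarrow> norm (jet_map n d w - (\<Sum>i<?N. jet_coeff n d i * w ^ i)) \<le> C * norm w ^ ?N"
    using jet_map_expansion[where n = n and d = d and N = "?N"] by blast
  obtain C' \<delta>' where C': "C' \<ge> 0" "\<delta>' > 0"
    "\<And>w. norm w \<le> \<delta>' \<Longrightarrow> norm (jet_map n d' w - (\<Sum>i<?N. jet_coeff n d' i * w ^ i)) \<le> C' * norm w ^ ?N"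
    using jet_map_expansion[where n = n and d = d' and N = "?N"] by blast
  let ?S = "\<Sum>k=1..n. \<bar>d k - d' k\<bar>"
  let ?r = "min (min \<delta> \<delta>') (min (jet_radius n d) (jet_radius n d'))"
  have "jet_coeff n d j - jet_coeff n d' j = 0"
  proof (rule asymptotic_coeffs_zero[OF _ _ j])
    show "?r > 0" using C C' jet_radius_pos by auto
    fix x :: real assume x: "0 < x" "x < ?r"
    let ?P = "\<lambda>d. \<Sum>i<?N. jet_coeff n d i * of_real x ^ i"
    have nx: "norm (complex_of_real x) = x" using x by simp
    have e: "norm (complex_of_real x) \<le> 1" "norm (complex_of_real x) \<le> jet_radius n d"
      "norm (complex_of_real x) \<le> jet_radius n d'" "norm (complex_of_real x) \<le> \<delta>" "norm (complex_of_real x) \<le> \<delta>'"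
      unfolding nx using x(2) jet_radius_le_1[of n d] by linarith+
    have tri: "norm (p - q) \<le> norm (a - b) + norm (a - p) + norm (b - q)" for a b p q :: complex
      by norm
    have 1: "norm (jet_map n d (of_real x) - jet_map n d' (of_real x)) \<le> 12 * (?S * x ^ ?N)"
      unfolding jet_map_def
    proof (rule profile_lipschitz)
      fix y :: real assume "y \<in> {0..1}"
      from jet_driver_diff_le[OF this e(1) eq]
      show "norm (jet_driver n d (of_real x) y - jet_driver n d' (of_real x) y) \<le> ?S * x ^ ?N"
        unfolding nx .
    qed (simp_all only: small_jet_driver e atLeastAtMost_iff order_refl zero_le_one)
    have 2: "norm (jet_map n d (of_real x) - ?P d) \<le> C * x ^ ?N" and 3: "norm (jet_map n d' (of_real x) - ?P d') \<le> C' * x ^ ?N"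
      using C(3)[OF e(4)] C'(3)[OF e(5)] unfolding nx by this+
    have 4: "norm (?P d - ?P d') \<le> norm (jet_map n d (of_real x) - jet_map n d' (of_real x))
        + norm (jet_map n d (of_real x) - ?P d) + norm (jet_map n d' (of_real x) - ?P d')"
      by (rule tri)
    have 5: "(\<Sum>i<?N. (jet_coeff n d i - jet_coeff n d' i) * of_real x ^ i) = ?P d - ?P d'"
      unfolding left_diff_distrib by (rule sum_subtractf)
    show "norm (\<Sum>i<?N. (jet_coeff n d i - jet_coeff n d' i) * of_real x ^ i) \<le> (12 * ?S + C + C') * x ^ ?N"
      unfolding 5 distrib_right mult.assoc by (rule order_trans[OF 4 add_mono[OF add_mono[OF 1 2] 3]])
  qed
  then show ?thesis by simp
qed

section \<open>Expansion of the curve\<close>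

lemma holder_CnD:
  assumes "holder_Cn n \<alpha> T lam D"
  shows "t \<in> {0..T} \<Longrightarrow> D 0 t = lam t"
    and "k < n \<Longrightarrow> t \<in> {0..T} \<Longrightarrow> (D k has_real_derivative D (Suc k) t) (at t within {0..T})"
    and "k \<le> n \<Longrightarrow> continuous_on {0..T} (D k)"
    and "k \<le> n \<Longrightarrow> bounded (D k ` {0..T})"
  using assms unfolding holder_Cn_def by blast+

text \<open>The base case is the Hoelder condition on \<open>D n\<close>. The remainder of
  \<open>D (n - Suc i)\<close> vanishes at 0 and has that of \<open>D (n - i)\<close> as derivative,
  so the mean value inequality gains a factor \<open>s\<close>.\<close>

lemma holder_taylor:
  assumes H: "holder_Cn n \<alpha> T lam D" and \<alpha>: "0 < \<alpha>"
  shows "i \<le> n \<Longrightarrow> \<exists>C\<ge>0. \<forall>s\<in>{0..T}.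
    \<bar>D (n - i) s - (\<Sum>l<Suc i. D (n - i + l) 0 / fact l * s ^ l)\<bar> \<le> C * s powr (real i + \<alpha>)"
proof (induction i)
  case 0
  obtain C where C: "\<And>s t. s \<in> {0..T} \<Longrightarrow> t \<in> {0..T} \<Longrightarrow> \<bar>D n s - D n t\<bar> \<le> C * \<bar>s - t\<bar> powr \<alpha>"
    using H unfolding holder_Cn_def by blast
  show ?case
  \<comment> \<open>The Hoelder constant is not assumed nonnegative, hence the absolute
    value.\<close>
  proof (intro exI[of _ "\<bar>C\<bar>"] conjI ballI)
    fix s assume s: "s \<in> {0..T}"
    have "\<bar>D n s - D n 0\<bar> \<le> C * s powr \<alpha>" using C[of s 0] s by auto
    also have "\<dots> \<le> \<bar>C\<bar> * s powr \<alpha>" by (intro mult_right_mono) auto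
    finally show "\<bar>D (n - 0) s - (\<Sum>l<Suc 0. D (n - 0 + l) 0 / fact l * s ^ l)\<bar> \<le> \<bar>C\<bar> * s powr (real 0 + \<alpha>)" by simp
  qed auto
next
  case (Suc i)
  define p where "p = n - Suc i"
  have p: "n - i = Suc p" "p < n" using Suc.prems by (auto simp: p_def)
  define R where "R s = D p s - (\<Sum>l<Suc (Suc i). D (p + l) 0 / fact l * s ^ l)" for s
  define R' where "R' s = D (Suc p) s - (\<Sum>l<Suc i. D (Suc p + l) 0 / fact l * s ^ l)" for s
  obtain C where C: "C \<ge> 0" "\<And>s. s \<in> {0..T} \<Longrightarrow> \<bar>R' s\<bar> \<le> C * s powr (real i + \<alpha>)"
    using Suc.IH[OF Suc_leD[OF Suc.prems]] unfolding p(1) R'_def by blast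
  have dR: "(R has_real_derivative R' s) (at s within {0..T})" if "s \<in> {0..T}" for s
  proof -
    have "((\<lambda>s. D (p + 0) 0 / fact 0 * s ^ 0 + (\<Sum>l<Suc i. D (p + Suc l) 0 / fact (Suc l) * s ^ Suc l)) has_real_derivative
        0 + (\<Sum>l<Suc i. D (p + Suc l) 0 / fact (Suc l) * (real (Suc l) * s ^ (Suc l - Suc 0)))) (at s within {0..T})"
      by (intro DERIV_add DERIV_sum DERIV_cmult DERIV_pow) simp
    then have "((\<lambda>s. \<Sum>l<Suc (Suc i). D (p + l) 0 / fact l * s ^ l) has_real_derivative
        (\<Sum>l<Suc i. D (p + Suc l) 0 / fact (Suc l) * (real (Suc l) * s ^ l))) (at s within {0..T})"
      unfolding sum.lessThan_Suc_shift[of _ "Suc i"] by simp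
    also have "(\<Sum>l<Suc i. D (p + Suc l) 0 / fact (Suc l) * (real (Suc l) * s ^ l))
        = (\<Sum>l<Suc i. D (Suc p + l) 0 / fact l * s ^ l)"
      by (intro sum.cong refl) (simp add: field_simps del: of_nat_Suc)
    finally show ?thesis
      unfolding R_def R'_def by (intro DERIV_diff holder_CnD(2)[OF H p(2) that])
  qed
  have R0: "R 0 = 0" unfolding R_def sum.lessThan_Suc_shift by simp
  have "\<bar>R s\<bar> \<le> C * s powr (real (Suc i) + \<alpha>)" if s: "s \<in> {0..T}" for s
  proof -
    have "norm (R s - R 0) \<le> (C * s powr (real i + \<alpha>)) * norm (s - 0)"
    proof (rule field_differentiable_bound[of "{0..s}" R R'])
      fix r assume r: "r \<in> {0..s}"
      show "(R has_real_derivative R' r) (at r within {0..s})"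
        by (rule DERIV_subset[OF dR]) (use r s in auto)
      have "\<bar>R' r\<bar> \<le> C * r powr (real i + \<alpha>)" using C(2)[of r] r s by auto
      also have "\<dots> \<le> C * s powr (real i + \<alpha>)"
        using r \<alpha> C(1) by (intro mult_left_mono powr_mono2) auto
      finally show "norm (R' r) \<le> C * s powr (real i + \<alpha>)" by simp
    qed (use s in auto)
    also have "s powr (real i + \<alpha>) * s = s powr (real (Suc i) + \<alpha>)"
      using s by (cases "s = 0") (auto simp: powr_add powr_realpow algebra_simps)
    then have "(C * s powr (real i + \<alpha>)) * norm (s - 0) = C * s powr (real (Suc i) + \<alpha>)"
      using s by (simp add: mult.assoc)
    finally show ?thesis using R0 by simp
  qed
  then show ?case using C(1) unfolding R_def p_def by blast
qed

lemma holder_derivative_taylor: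
  assumes H: "holder_Cn n \<alpha> T lam D" and \<alpha>: "0 < \<alpha>" and n: "n \<ge> 1"
  shows "\<exists>C\<ge>0. \<forall>s\<in>{0..T}.
    \<bar>D 1 s - (\<Sum>k=1..n. D k 0 / fact (k - 1) * s ^ (k - 1))\<bar> \<le> C * s powr (real (n - 1) + \<alpha>)"
proof -
  have "(\<Sum>l<Suc (n - 1). D (1 + l) 0 / fact l * s ^ l) = (\<Sum>k=1..n. D k 0 / fact (k - 1) * s ^ (k - 1))" for s
    using n by (simp add: sum.atLeast1_atMost_eq del: sum.lessThan_Suc)
  moreover have "n - (n - 1) = 1" using n by simp
  ultimately show ?thesis using holder_taylor[OF H \<alpha> diff_le_self[of n 1]] by (simp only:)
qed

text \<open>By \<open>jet_coeff_parity\<close> the discarded part vanishes, so the chosen one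
  carries the whole coefficient. The shift \<open>m - 1\<close> accounts for the outer factor
  \<open>sqrt t\<close>.\<close>

definition loewner_coeff :: "nat \<Rightarrow> nat \<Rightarrow> (nat \<Rightarrow> real) \<Rightarrow> real" where
  "loewner_coeff n m d = (if even m then Re (jet_coeff n d (m - 1)) else Im (jet_coeff n d (m - 1)))"

lemma exp_term_loewner_coeff:
  assumes m: "m \<ge> 1" and t: "t > 0"
  shows "exp_term m (loewner_coeff n m d) t = jet_coeff n d (m - 1) * of_real (sqrt t) ^ m"
proof -
  let ?c = "jet_coeff n d (m - 1)"
  have "sqrt t ^ m = t powr (real m / 2)"
    using t by (simp add: powr_half_sqrt[symmetric] powr_power)
  then have pw: "complex_of_real (t powr (real m / 2)) = of_real (sqrt t) ^ m"
    by (metis of_real_power)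
  have "(if even m then 1 else \<i>) * of_real (loewner_coeff n m d) = ?c"
  proof (cases "even m")
    case True
    then have "odd (m - 1)" using m by auto
    then have "cnj ?c = ?c" using jet_coeff_parity[of "m - 1" n d] by simp
    then show ?thesis using True by (simp add: loewner_coeff_def complex_eq_iff)
  next
    case False
    then have "even (m - 1)" by auto
    then have "?c + cnj ?c = 0" using jet_coeff_parity[of "m - 1" n d] by simp
    then show ?thesis using False by (simp add: loewner_coeff_def complex_eq_iff)
  qed
  then show ?thesis unfolding exp_term_def of_real_mult pw by (simp only: mult.assoc[symmetric])
qed

text \<open>The term \<open>2 * n + 1\<close> is split off because the final expansion keeps it only
  for \<open>\<alpha> > 1/2\<close>.\<close>

lemma loewner_coeff_sum:
  assumes t: "t > 0" and n: "n \<ge> 1"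
  shows "of_real (sqrt t) * (\<Sum>j<2*n+1. jet_coeff n d j * of_real (sqrt t) ^ j)
    = 2 * \<i> * of_real (sqrt t) + (\<Sum>m=2..2*n. exp_term m (loewner_coeff n m d) t)
      + exp_term (2*n+1) (loewner_coeff n (2*n+1) d) t"
proof -
  have "of_real (sqrt t) * (\<Sum>j<2*n+1. jet_coeff n d j * of_real (sqrt t) ^ j)
      = (\<Sum>j<2*n+1. exp_term (Suc j) (loewner_coeff n (Suc j) d) t)"
    unfolding sum_distrib_left
    by (intro sum.cong refl) (subst exp_term_loewner_coeff; use t in simp)
  also have "\<dots> = (\<Sum>m=1..2*n+1. exp_term m (loewner_coeff n m d) t)"
    by (simp only: One_nat_def sum.atLeast1_atMost_eq)
  also have "\<dots> = exp_term 1 (loewner_coeff n 1 d) t + (\<Sum>m=2..2*n+1. exp_term m (loewner_coeff n m d) t)"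
    by (subst sum.atLeast_Suc_atMost) (auto simp: numeral_2_eq_2)
  also have "exp_term 1 (loewner_coeff n 1 d) t = 2 * \<i> * of_real (sqrt t)"
    using exp_term_loewner_coeff[OF _ t, of 1] by (simp add: jet_coeff_0)
  also have "(\<Sum>m=2..2*n+1. exp_term m (loewner_coeff n m d) t)
      = (\<Sum>m=2..2*n. exp_term m (loewner_coeff n m d) t) + exp_term (2*n+1) (loewner_coeff n (2*n+1) d) t"
    using n by simp
  finally show ?thesis by (simp only: add.assoc)
qed

text \<open>Two errors add up. Replacing the driver costs
  \<open>sqrt t * t powr (n - 1 + \<alpha>)\<close> in the profile, truncating the Taylor series
  costs \<open>sqrt t ^ (2 * n + 1)\<close>, and both gain the outer \<open>sqrt t\<close>.\<close>

lemma curve_expansion_bound: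
  assumes n: "n \<ge> 1" and \<alpha>: "0 < \<alpha>" and T: "T > 0" and lam0: "lam 0 = 0"
    and H: "holder_Cn n \<alpha> T lam D" and gen: "generates_curve T lam gam"
  shows "\<exists>C\<ge>0. \<exists>\<delta>>0. \<forall>t. 0 < t \<and> t < \<delta> \<longrightarrow>
    norm (gam t - of_real (sqrt t) * (\<Sum>j<2*n+1. jet_coeff n (\<lambda>k. D k 0) j * of_real (sqrt t) ^ j))
      \<le> C * t powr (real n + \<alpha>) + C * t powr (real n + 1)"
proof -
  define d where "d = (\<lambda>k. D k 0)"
  obtain M where M: "M > 0" "\<And>s. s \<in> {0..T} \<Longrightarrow> \<bar>D 1 s\<bar> \<le> M"
  proof -
    have "bounded (D 1 ` {0..T})" by (rule holder_CnD(4)[OF H n])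
    then show ?thesis using that by (auto simp: bounded_pos)
  qed
  \<comment> \<open>The second entry makes \<open>sqrt t0 * M \<le> 1/24\<close>.\<close>
  define t0 where "t0 = min T ((1 / (24 * M))\<^sup>2)"
  have t0: "t0 > 0" "t0 \<le> T" using T M by (auto simp: t0_def)
  have "sqrt t0 \<le> sqrt ((1 / (24 * M))\<^sup>2)" by (simp only: real_sqrt_le_iff) (simp add: t0_def)
  then have st0: "sqrt t0 \<le> 1 / (24 * M)" using M by simp
  have L: "small_loewner_driver lam (D 1) t0"
    unfolding small_loewner_driver_def
  proof (intro conjI ballI)
    show "continuous_on {0..t0} (D 1)"
      by (rule continuous_on_subset[OF holder_CnD(3)[OF H n]]) (use t0 in auto)
    fix s assume s: "s \<in> {0..t0}"
    then have sT: "s \<in> {0..T}" using t0 by auto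
    have "(D 0 has_real_derivative D 1 s) (at s within {0..T})"
      using holder_CnD(2)[OF H _ sT, of 0] n by simp
    then have "(D 0 has_real_derivative D 1 s) (at s within {0..t0})"
      by (rule DERIV_subset) (use t0 in auto)
    then show "(lam has_real_derivative D 1 s) (at s within {0..t0})"
      by (rule has_field_derivative_transform_within[of _ _ _ _ 1])
         (use s t0 holder_CnD(1)[OF H] in auto)
    have "sqrt t0 * \<bar>D 1 s\<bar> \<le> 1 / (24 * M) * M" using st0 M t0 sT by (intro mult_mono) auto
    then show "sqrt t0 * \<bar>D 1 s\<bar> \<le> 1 / 24" using M by simp
  qed (use t0 lam0 in auto)
  obtain t1 where t1: "t1 > 0" "t1 \<le> t0" "\<And>t. t \<in> {0<..<t1} \<Longrightarrow> gam t = tip (D 1) t"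
    using curve_eq_tip[OF L gen t0(2)] by blast
  obtain C1 where C1: "C1 \<ge> 0" "\<And>s. s \<in> {0..T} \<Longrightarrow>
    \<bar>D 1 s - (\<Sum>k=1..n. D k 0 / fact (k - 1) * s ^ (k - 1))\<bar> \<le> C1 * s powr (real (n - 1) + \<alpha>)"
    using holder_derivative_taylor[OF H \<alpha> n] by blast
  obtain C2 \<delta> where C2: "C2 \<ge> 0" "\<delta> > 0" "\<And>w. norm w \<le> \<delta> \<Longrightarrow>
      norm (jet_map n d w - (\<Sum>j<2*n+1. jet_coeff n d j * w ^ j)) \<le> C2 * norm w ^ (2*n+1)"
    using jet_map_expansion[of n d "2*n+1"] by blast
  \<comment> \<open>The later condition \<open>t < r^2\<close> puts \<open>sqrt t\<close> in the
    range of the Taylor bound and within the jet radius.\<close>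
  define r where "r = min \<delta> (jet_radius n d)"
  have r: "r > 0" using C2 jet_radius_pos by (auto simp: r_def)
  have main: "norm (gam t - of_real (sqrt t) * (\<Sum>j<2*n+1. jet_coeff n d j * of_real (sqrt t) ^ j))
      \<le> 12 * C1 * t powr (real n + \<alpha>) + C2 * t powr (real n + 1)"
    if t: "0 < t" "t < min t1 (r\<^sup>2)" for t
  proof -
    let ?e = "complex_of_real (sqrt t)"
    have "sqrt t < sqrt (r\<^sup>2)" using t by (simp only: real_sqrt_less_iff)
    then have tr: "sqrt t \<le> \<delta>" "sqrt t \<le> jet_radius n d" using r by (auto simp: r_def)
    have "norm (profile (rescaled_driver (D 1) t) 1 - jet_map n d ?e) \<le> 12 * (sqrt t * (C1 * t powr (real (n - 1) + \<alpha>)))"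
      unfolding jet_map_def
    proof (rule profile_lipschitz)
      show "small_driver (rescaled_driver (D 1) t)" using t t1 by (intro small_rescaled_driver[OF L]) auto
      show "small_driver (jet_driver n d ?e)" using t tr by (intro small_jet_driver) auto
      fix x :: real assume x: "x \<in> {0..1}"
      let ?s = "t * (1 - x\<^sup>2)"
      have x2: "x\<^sup>2 \<le> 1" using x by (auto intro: power_le_one)
      have "?s \<in> {0..t0}" using t t1 x by (intro rescaled_time[OF L]) auto
      then have "\<bar>D 1 ?s - (\<Sum>k=1..n. D k 0 / fact (k - 1) * ?s ^ (k - 1))\<bar> \<le> C1 * ?s powr (real (n - 1) + \<alpha>)"
        using t0 by (intro C1(2)) auto
      also have "\<dots> \<le> C1 * t powr (real (n - 1) + \<alpha>)"
        using t x2 \<alpha> C1(1) by (intro mult_left_mono powr_mono2) (auto simp: mult_le_cancel_left1)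
      finally have le: "\<bar>D 1 ?s - (\<Sum>k=1..n. D k 0 / fact (k - 1) * ?s ^ (k - 1))\<bar> \<le> C1 * t powr (real (n - 1) + \<alpha>)" .
      have "jet_driver n d ?e x = (\<Sum>k=1..n. of_real (sqrt t * (D k 0 / fact (k - 1) * ?s ^ (k - 1))))"
        unfolding jet_driver_def
      proof (rule sum.cong[OF refl])
        fix k assume "k \<in> {1..n}"
        \<comment> \<open>As \<open>k \<ge> 1\<close>, truncated subtraction is harmless and the
          power splits into \<open>sqrt t\<close> and \<open>t ^ (k - 1)\<close>.\<close>
        then have "2 * k - 1 = Suc (2 * (k - 1))" by auto
        then have "sqrt t ^ (2 * k - 1) = sqrt t * t ^ (k - 1)" using t by (simp add: power_mult)
        then have "d k / fact (k - 1) * (1 - x\<^sup>2) ^ (k - 1) * sqrt t ^ (2 * k - 1)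
            = sqrt t * (D k 0 / fact (k - 1) * ?s ^ (k - 1))"
          by (simp add: d_def power_mult_distrib)
        then show "of_real (d k / fact (k - 1) * (1 - x\<^sup>2) ^ (k - 1)) * ?e ^ (2 * k - 1)
            = complex_of_real (sqrt t * (D k 0 / fact (k - 1) * ?s ^ (k - 1)))"
          unfolding of_real_power[symmetric] of_real_mult[symmetric] by (rule arg_cong)
      qed
      then have "rescaled_driver (D 1) t x - jet_driver n d ?e x
          = of_real (sqrt t * (D 1 ?s - (\<Sum>k=1..n. D k 0 / fact (k - 1) * ?s ^ (k - 1))))"
        unfolding rescaled_driver_def right_diff_distrib sum_distrib_left by (simp only: of_real_diff of_real_sum)
      then have "norm (rescaled_driver (D 1) t x - jet_driver n d ?e x)
          = sqrt t * \<bar>D 1 ?s - (\<Sum>k=1..n. D k 0 / fact (k - 1) * ?s ^ (k - 1))\<bar>"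
        using t by (simp only: norm_of_real abs_mult) simp
      also have "\<dots> \<le> sqrt t * (C1 * t powr (real (n - 1) + \<alpha>))"
        using t by (intro mult_left_mono le) auto
      finally show "norm (rescaled_driver (D 1) t x - jet_driver n d ?e x) \<le> sqrt t * (C1 * t powr (real (n - 1) + \<alpha>))" .
    qed simp
    then have "sqrt t * norm (profile (rescaled_driver (D 1) t) 1 - jet_map n d ?e)
        \<le> sqrt t * (12 * (sqrt t * (C1 * t powr (real (n - 1) + \<alpha>))))"
      using t by (intro mult_left_mono) auto
    also have "\<dots> = 12 * C1 * ((sqrt t * sqrt t) * t powr (real (n - 1) + \<alpha>))" by (simp only: mult_ac)
    also have "sqrt t * sqrt t = t powr 1" using t by simp
    also have "t powr 1 * t powr (real (n - 1) + \<alpha>) = t powr (real n + \<alpha>)"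
      unfolding powr_add[symmetric] using n by (simp only: of_nat_diff) simp
    finally have 1: "norm (?e * (profile (rescaled_driver (D 1) t) 1 - jet_map n d ?e)) \<le> 12 * C1 * t powr (real n + \<alpha>)"
      using t by (simp add: norm_mult)
    have "norm (jet_map n d ?e - (\<Sum>j<2*n+1. jet_coeff n d j * ?e ^ j)) \<le> C2 * sqrt t ^ (2*n+1)"
      using C2(3)[of ?e] tr t by (simp only: norm_of_real) simp
    then have "sqrt t * norm (jet_map n d ?e - (\<Sum>j<2*n+1. jet_coeff n d j * ?e ^ j)) \<le> sqrt t * (C2 * sqrt t ^ (2*n+1))"
      using t by (intro mult_left_mono) auto
    also have "\<dots> = C2 * (sqrt t ^ 2) ^ (n + 1)" 
    proof -
      have "2 * (n + 1) = Suc (2*n+1)" by simp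
      then show ?thesis unfolding power_mult[symmetric] by (simp only: power_Suc mult.left_commute)
    qed
    also have "(sqrt t ^ 2) ^ (n + 1) = t powr (real n + 1)" using t by (simp add: powr_add powr_realpow)
    finally have 2: "norm (?e * (jet_map n d ?e - (\<Sum>j<2*n+1. jet_coeff n d j * ?e ^ j))) \<le> C2 * t powr (real n + 1)"
      using t by (simp add: norm_mult)
    have "gam t = ?e * profile (rescaled_driver (D 1) t) 1" using t1(3)[of t] t by (simp add: tip_def)
    then have "gam t - ?e * (\<Sum>j<2*n+1. jet_coeff n d j * ?e ^ j)
        = ?e * (profile (rescaled_driver (D 1) t) 1 - jet_map n d ?e)
          + ?e * (jet_map n d ?e - (\<Sum>j<2*n+1. jet_coeff n d j * ?e ^ j))"
      by (simp only: right_diff_distrib) simp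
    then show ?thesis by (simp only: norm_triangle_le[OF add_mono[OF 1 2]])
  qed
  define C where "C = max (12 * C1) C2"
  have C: "C \<ge> 0" "12 * C1 \<le> C" "C2 \<le> C" using C1(1) by (simp_all add: C_def)
  have "norm (gam t - of_real (sqrt t) * (\<Sum>j<2*n+1. jet_coeff n d j * of_real (sqrt t) ^ j))
      \<le> C * t powr (real n + \<alpha>) + C * t powr (real n + 1)"
    if t: "0 < t" "t < min t1 (r\<^sup>2)" for t
    by (rule order_trans[OF main[OF t]]) (intro add_mono mult_right_mono C powr_ge_zero)
  moreover have "min t1 (r\<^sup>2) > 0" using t1 r by simp
  ultimately show ?thesis using C(1) unfolding d_def by blast
qed

theorem theorem1p3:
  fixes n :: nat and \<alpha> :: real
  assumes "n \<ge> 1" and "0 < \<alpha>" and "\<alpha> \<le> 1"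
  shows "\<exists>a :: nat \<Rightarrow> (nat \<Rightarrow> real) \<Rightarrow> real.
    (\<forall>m\<in>{2..2*n+1}. \<forall>d d'. (\<forall>k\<in>{1..m div 2}. d k = d' k) \<longrightarrow> a m d = a m d') \<and>
    (\<forall>T lam gam D. T > 0 \<longrightarrow> lam 0 = 0 \<longrightarrow> holder_Cn n \<alpha> T lam D \<longrightarrow>
        generates_curve T lam gam \<longrightarrow>
        (\<lambda>t. gam t - (2 * \<i> * complex_of_real (sqrt t)
                        + (\<Sum>m=2..2*n. exp_term m (a m (\<lambda>k. D k 0)) t)
                        + (if \<alpha> > 1/2 then exp_term (2*n+1) (a (2*n+1) (\<lambda>k. D k 0)) t else 0)))
          \<in> O[at_right 0](\<lambda>t. complex_of_real (t powr (real n + \<alpha>))))"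
proof (intro exI[of _ "loewner_coeff n"] conjI ballI allI impI)
  fix m and d d' :: "nat \<Rightarrow> real"
  assume "m \<in> {2..2*n+1}" "\<forall>k\<in>{1..m div 2}. d k = d' k"
  then have "jet_coeff n d (m - 1) = jet_coeff n d' (m - 1)"
    \<comment> \<open>For either parity of \<open>m\<close>,
      \<open>m - 1 < 2 * (m div 2) + 1\<close>.\<close>
    by (intro jet_coeff_cong[of "m div 2"]) (blast, arith)
  then show "loewner_coeff n m d = loewner_coeff n m d'" by (simp add: loewner_coeff_def)
next
  fix T :: real and lam gam and D :: "nat \<Rightarrow> real \<Rightarrow> real"
  assume hyps: "T > 0" "lam 0 = 0" "holder_Cn n \<alpha> T lam D" "generates_curve T lam gam"
  define b where "b m = loewner_coeff n m (\<lambda>k. D k 0)" for m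
  obtain C \<delta> where C: "C \<ge> 0" and \<delta>: "\<delta> > 0" and bound: "\<And>t. 0 < t \<Longrightarrow> t < \<delta> \<Longrightarrow>
    norm (gam t - of_real (sqrt t) * (\<Sum>j<2*n+1. jet_coeff n (\<lambda>k. D k 0) j * of_real (sqrt t) ^ j))
      \<le> C * t powr (real n + \<alpha>) + C * t powr (real n + 1)"
    using curve_expansion_bound[OF assms(1,2) hyps] by blast
  have "(\<lambda>t. gam t - (2 * \<i> * complex_of_real (sqrt t) + (\<Sum>m=2..2*n. exp_term m (b m) t)
      + (if \<alpha> > 1/2 then exp_term (2*n+1) (b (2*n+1)) t else 0)))
      \<in> O[at_right 0](\<lambda>t. complex_of_real (t powr (real n + \<alpha>)))"
  \<comment> \<open>The second \<open>C\<close> absorbs \<open>t powr (n + 1)\<close>, using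
    \<open>\<alpha> \<le> 1\<close> and \<open>t \<le> 1\<close>. The last summand absorbs the
    half-integer term \<open>t powr (n + 1/2)\<close>, omitted from the expansion when
    \<open>\<alpha> \<le> 1/2\<close>.\<close>
  proof (rule bigoI[of _ "C + C + \<bar>b (2*n+1)\<bar>"])
    have "\<forall>\<^sub>F t in at_right 0. t \<in> {0<..<min \<delta> 1}"
      using \<delta> by (intro eventually_at_rightI[of 0 "min \<delta> 1"]) auto
    then show "\<forall>\<^sub>F t in at_right 0. norm (gam t - (2 * \<i> * complex_of_real (sqrt t) + (\<Sum>m=2..2*n. exp_term m (b m) t)
      + (if \<alpha> > 1/2 then exp_term (2*n+1) (b (2*n+1)) t else 0)))
        \<le> (C + C + \<bar>b (2*n+1)\<bar>) * norm (complex_of_real (t powr (real n + \<alpha>)))"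
    proof eventually_elim
      case (elim t)
      then have t: "0 < t" "t < \<delta>" "t \<le> 1" by auto
      let ?E = "exp_term (2*n+1) (b (2*n+1)) t" and ?p = "t powr (real n + \<alpha>)"
      let ?S = "2 * \<i> * complex_of_real (sqrt t) + (\<Sum>m=2..2*n. exp_term m (b m) t)"
      have "norm (gam t - (?S + ?E)) \<le> C * ?p + C * t powr (real n + 1)"
        using bound[OF t(1,2)] unfolding b_def loewner_coeff_sum[OF t(1) assms(1)] .
      moreover have "C * t powr (real n + 1) \<le> C * ?p"
        using t assms C by (intro mult_left_mono powr_mono') auto
      ultimately have 1: "norm (gam t - (?S + ?E)) \<le> C * ?p + C * ?p" by linarith
      show ?case
      proof (cases "\<alpha> > 1/2")
        case True
        have "0 \<le> \<bar>b (2*n+1)\<bar> * ?p" by simp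
        with 1 have "norm (gam t - (?S + ?E)) \<le> C * ?p + C * ?p + \<bar>b (2*n+1)\<bar> * ?p" by linarith
        then show ?thesis unfolding if_P[OF True] norm_of_real abs_of_nonneg[OF powr_ge_zero] distrib_right .
      next
        case False
        have "norm ?E = \<bar>b (2*n+1)\<bar> * t powr (real (2*n+1) / 2)"
          by (simp add: exp_term_def norm_mult abs_mult)
        also have "\<dots> \<le> \<bar>b (2*n+1)\<bar> * ?p"
          using t False by (intro mult_left_mono powr_mono') auto
        finally have 2: "norm ?E \<le> \<bar>b (2*n+1)\<bar> * ?p" .
        have "gam t - ?S = (gam t - (?S + ?E)) + ?E" by simp
        then have "norm (gam t - ?S) \<le> C * ?p + C * ?p + \<bar>b (2*n+1)\<bar> * ?p"
          by (simp only: norm_triangle_le[OF add_mono[OF 1 2]])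
        then show ?thesis
          unfolding if_not_P[OF False] add_0_right norm_of_real abs_of_nonneg[OF powr_ge_zero] distrib_right .
      qed
    qed
  qed
  then show "(\<lambda>t. gam t - (2 * \<i> * complex_of_real (sqrt t)
        + (\<Sum>m=2..2*n. exp_term m (loewner_coeff n m (\<lambda>k. D k 0)) t)
        + (if \<alpha> > 1/2 then exp_term (2*n+1) (loewner_coeff n (2*n+1) (\<lambda>k. D k 0)) t else 0)))
      \<in> O[at_right 0](\<lambda>t. complex_of_real (t powr (real n + \<alpha>)))"
    unfolding b_def .
qed

end
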